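(* For each integer $k \geq 1$, there exists a planar triangulation $G$ on $52k$ vertices for which $a(G) \leq 25k$.
   Context: All graphs are finite, simple and non-empty. For a graph $G$, $a(G)$ denotes the maximum of $|F|$ over all $F\subseteq V(G)$ such that the induced subgraph $G[F]$ is a forest (acyclic). A planar triangulation is a simple planar graph that has a planar embedding in which every face (including the outer one) is a triangle. *)

theory Defs
  imports "HOL-Analysis.Analysis"
begin

text \<open>A graph is given by its vertex set \<open>V\<close> and its set \<open>E\<close> of edges, an edge being the
  two-element set of its end vertices.\<close>

definition simple_graph :: "'a set \<Rightarrow> 'a set set \<Rightarrow> bool" where
  "simple_graph V E \<longleftrightarrow> finite V \<and> V \<noteq> {} \<and> (\<forall>e\<in>E. e \<subseteq> V \<and> card e = 2)"

definition graph_cycle :: "'a set set \<Rightarrow> 'a list \<Rightarrow> bool" where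
  "graph_cycle E vs \<longleftrightarrow> length vs \<ge> 3 \<and> distinct vs \<and>
     (\<forall>i<length vs. {vs ! i, vs ! (Suc i mod length vs)} \<in> E)"

definition forest :: "'a set set \<Rightarrow> bool" where
  "forest E \<longleftrightarrow> (\<nexists>vs. graph_cycle E vs)"

definition induced_edges :: "'a set set \<Rightarrow> 'a set \<Rightarrow> 'a set set" where
  "induced_edges E F = {e \<in> E. e \<subseteq> F}"

definition max_induced_forest :: "'a set \<Rightarrow> 'a set set \<Rightarrow> nat" where
  "max_induced_forest V E = Max (card ` {F. F \<subseteq> V \<and> forest (induced_edges E F)})"

text \<open>A drawing in the plane places each vertex \<open>v\<close> at the point \<open>p v\<close> and represents each edge
  \<open>e\<close> by a Jordan arc \<open>g e\<close>. The orientation of \<open>g e\<close> is irrelevant.\<close>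

definition planar_embedding ::
  "'a set \<Rightarrow> 'a set set \<Rightarrow> ('a \<Rightarrow> complex) \<Rightarrow> ('a set \<Rightarrow> real \<Rightarrow> complex) \<Rightarrow> bool" where
  "planar_embedding V E p g \<longleftrightarrow>
     inj_on p V \<and>
     (\<forall>e\<in>E. arc (g e) \<and> {pathstart (g e), pathfinish (g e)} = p ` e) \<and>
     (\<forall>e\<in>E. g e ` {0<..<1} \<inter> p ` V = {}) \<and>
     (\<forall>e\<in>E. \<forall>e'\<in>E. e \<noteq> e' \<longrightarrow> g e ` {0<..<1} \<inter> path_image (g e') = {})"

definition embedding_faces ::
  "'a set \<Rightarrow> 'a set set \<Rightarrow> ('a \<Rightarrow> complex) \<Rightarrow> ('a set \<Rightarrow> real \<Rightarrow> complex) \<Rightarrow> complex set set" where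
  "embedding_faces V E p g = components (- (p ` V \<union> (\<Union>e\<in>E. path_image (g e))))"

text \<open>A face is a triangle if its boundary is exactly the drawing of a 3-cycle of the graph; this
  also makes sense for the unbounded face.\<close>

definition triangular_face ::
  "'a set set \<Rightarrow> ('a set \<Rightarrow> real \<Rightarrow> complex) \<Rightarrow> complex set \<Rightarrow> bool" where
  "triangular_face E g f \<longleftrightarrow>
     (\<exists>u v w. graph_cycle E [u, v, w] \<and>
        frontier f = path_image (g {u, v}) \<union> path_image (g {v, w}) \<union> path_image (g {w, u}))"

definition planar_triangulation :: "'a set \<Rightarrow> 'a set set \<Rightarrow> bool" where
  "planar_triangulation V E \<longleftrightarrow> simple_graph V E \<and>
     (\<exists>p g. planar_embedding V E p g \<and> (\<forall>f\<in>embedding_faces V E p g. triangular_face E g f))"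

end

theory Submission
  imports Defs "HOL-Library.Code_Binary_Nat"
begin

text \<open>
  The graph for \<open>k = 1\<close> is a complete graph on four vertices \<open>a, b, c, d\<close> with a gadget in each of its
  three faces at \<open>d\<close>. The core of a gadget is a plane graph on 16 vertices in which every induced
  forest has at most 8 vertices. On its outer 4-cycle there is a vertex \<open>s\<close> such that every induced
  forest with 8 vertices contains \<open>s\<close> or connects two of the other three vertices of that cycle. One
  vertex of the surrounding triangle, the apex, is joined to all four of them, and \<open>s\<close> is joined to
  all three vertices of the triangle. Hence a forest that contains the apex and another vertex of the
  triangle has at most 7 vertices in the core (\<open>gadget_bound\<close>): otherwise it contains a triangle
  through \<open>s\<close> or a cycle through the apex.

  With the apices \<open>a, b, c\<close> for the triangles \<open>abd, bcd, cad\<close>, each of the six edges of the complete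
  graph joins an apex to another vertex of its triangle. A forest has at most two vertices among
  \<open>a, b, c, d\<close>. With at most one, it has at most \<open>1 + 3 \<cdot> 8\<close> vertices; with two, it has at most
  \<open>2 + 7 + 8 + 8\<close>. In either case this is at most 25 (\<open>block_bound\<close>). For larger \<open>k\<close>, such
  blocks are nested into each other, and the bounds for the blocks add up (\<open>nested_blocks\<close>). The bound
  for the core is a finite statement about hitting sets of a list of cycles, which is verified by a
  branching procedure (\<open>hits_exceed_sound\<close>).

  For the triangulation itself, the graph is drawn in the plane step by step. Each step divides one
  face by an arc, which is either a new edge or a pair of new edges with a new vertex between them. The
  topology is in \<open>disc_face_split\<close>: a face is handled together with a homeomorphism from the closed
  disc onto its closure, the arc is the image of a chord, and the two half discs are models for the
  two new faces. All that has to be known about a face is then the cyclic list of its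
  vertices, and a drawing becomes a list of instructions on such lists, which can be executed
  (\<open>draw_all_sound\<close>).
\<close>

section \<open>Splitting a face along a chord\<close>

text \<open>Every bounded face is carried along with a homeomorphism from the closed unit disc onto its
  closure. A new edge inside the face can then be drawn as the image of a chord of the disc; in
  particular any two boundary points are joined by an arc through the face.\<close>

definition disc_face :: "complex set \<Rightarrow> complex set \<Rightarrow> bool" where
  "disc_face f B \<longleftrightarrow> (\<exists>h k. homeomorphism (cball (0::complex) 1) (closure f) h k \<and>
     h ` ball 0 1 = f \<and> h ` sphere 0 1 = B)"

lemma chord_eq_segment:
  fixes a b n :: complex
  assumes "norm a = 1" "norm b = 1" "a \<noteq> b" "n \<noteq> 0" "inner n a = t" "inner n b = t"
  shows "cball 0 1 \<inter> {z. inner n z = t} = closed_segment a b"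
proof (intro equalityI subsetI)
  fix z assume "z \<in> closed_segment a b"
  moreover have "closed_segment a b \<subseteq> cball 0 1 \<inter> {z. inner n z = t}"
    using assms by (intro closed_segment_subset convex_Int convex_cball convex_hyperplane) auto
  ultimately show "z \<in> cball 0 1 \<inter> {z. inner n z = t}" by blast
next
  fix z assume z: "z \<in> cball 0 1 \<inter> {z. inner n z = t}"
  define d where "d = b - a"
  have "d \<noteq> 0" using assms d_def by auto
  have nd: "inner n d = 0" and nz: "inner n (z - a) = 0"
    using assms z by (auto simp: d_def inner_diff_right)
  have "Re d * Im (z - a) = Im d * Re (z - a)"
  proof -
    have 1: "Re n * Re d + Im n * Im d = 0" "Re n * Re (z-a) + Im n * Im (z-a) = 0"
      using nd nz by (auto simp: inner_complex_def)
    have 2: "Re n \<noteq> 0 \<or> Im n \<noteq> 0" using \<open>n \<noteq> 0\<close> complex_eq_iff by auto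
    have "Re n * (Re d * Im (z - a) - Im d * Re (z - a)) = 0"
         "Im n * (Re d * Im (z - a) - Im d * Re (z - a)) = 0"
      using 1 by algebra+
    then show ?thesis using 2 by auto
  qed
  then have "Im (cnj d * (z - a)) = 0" by (simp add: algebra_simps)
  then obtain r where "cnj d * (z - a) = of_real r"
    by (metis complex_is_Real_iff Reals_cases)
  then have "d * cnj d * (z - a) = d * of_real r" by (simp add: mult.assoc)
  then have "of_real ((cmod d)\<^sup>2) * (z - a) = d * of_real r"
    by (simp add: complex_mult_cnj cmod_power2)
  then have "z - a = of_real (r / (cmod d)\<^sup>2) * d"
    using \<open>d \<noteq> 0\<close> by (simp add: field_simps)
  then obtain s where s: "z = a + s *\<^sub>R d"
    by (metis add_diff_cancel_left' diff_add_cancel add.commute scaleR_conv_of_real)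
  have aa: "inner a a = 1" "inner b b = 1" using assms by (auto simp: power2_norm_eq_inner [symmetric])
  then have "1 + 2 * inner a d + inner d d = 1" 
    unfolding d_def by (simp add: inner_diff_left inner_diff_right inner_commute)
  then have ad: "2 * inner a d = - inner d d" by simp
  have "inner z z \<le> 1" using z by (simp add: power2_norm_eq_inner [symmetric] power_le_one)
  then have "1 + s * (2 * inner a d) + s * s * inner d d \<le> 1"
    unfolding s using aa by (simp add: inner_add_left inner_add_right inner_commute algebra_simps)
  then have "(s * (s - 1)) * inner d d \<le> 0" unfolding ad by (simp add: algebra_simps)
  moreover have "inner d d > 0" using \<open>d \<noteq> 0\<close> by simp
  ultimately have "s * (s - 1) \<le> 0" by (simp only: mult_le_0_iff) linarith
  then have "0 \<le> s" "s \<le> 1" by (auto simp: mult_le_0_iff)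
  then show "z \<in> closed_segment a b"
    unfolding s d_def closed_segment_def by (auto simp: algebra_simps intro!: exI[of _ s])
qed

lemma half_disc_interior:
  fixes n :: complex
  assumes "n \<noteq> 0"
  shows "interior (cball 0 1 \<inter> {z. t \<le> inner n z}) = ball 0 1 \<inter> {z. t < inner n z}"
  using assms by (simp add: interior_Int interior_cball)

lemma homeomorphism_interior:
  fixes h :: "complex \<Rightarrow> complex"
  assumes "homeomorphism S T h k"
  shows "h ` interior S = interior T"
proof -
  have *: "h ` interior S \<subseteq> interior T" if "homeomorphism S T h k" for S T h and k :: "complex \<Rightarrow> complex"
  proof (rule interior_maximal)
    show "h ` interior S \<subseteq> T" using that interior_subset by (fastforce simp: homeomorphism_def)
    have "inj_on h S" using that by (metis homeomorphism_def inj_on_inverseI)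
    then show "open (h ` interior S)"
      using that by (intro invariance_of_domain)
        (auto simp: homeomorphism_def intro: inj_on_subset continuous_on_subset interior_subset dest: interior_subset[THEN subsetD])
  qed
  have "k ` interior T \<subseteq> interior S" using *[OF homeomorphism_symD[OF assms]] .
  moreover have "h ` k ` interior T = (\<lambda>x. x) ` interior T"
    unfolding image_image using assms interior_subset[of T]
    by (intro image_cong) (auto simp: homeomorphism_def)
  then have "h ` k ` interior T = interior T" by simp
  ultimately show ?thesis using *[OF assms] by blast
qed

text \<open>A chord cuts the disc into two convex pieces. All compact convex sets with interior points are
  homeomorphic to the disc, and by invariance of domain such a homeomorphism matches interiors with
  interiors; hence the images of the two pieces are again faces with a disc as a model.\<close>

lemma disc_face_convex_image:
  fixes h :: "complex \<Rightarrow> complex"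
  assumes h: "homeomorphism D (h ` D) h k" and D: "compact D" "convex D" "interior D \<noteq> {}"
  shows "disc_face (h ` interior D) (h ` (D - interior D))"
proof -
  have "aff_dim D = 2" using D(3) aff_dim_nonempty_interior[of D] by simp
  moreover have "aff_dim (cball (0::complex) 1) = 2" by (simp add: aff_dim_cball)
  ultimately have "cball (0::complex) 1 homeomorphic D"
    using D by (intro homeomorphic_convex_compact_sets) auto
  then obtain e e' where e: "homeomorphism (cball (0::complex) 1) D e e'"
    unfolding homeomorphic_def by blast
  have int: "e ` ball 0 1 = interior D"
    using homeomorphism_interior[OF e] by (simp add: interior_cball)
  have inj: "inj_on e (cball 0 1)" using e by (metis homeomorphism_def inj_on_inverseI)
  have "e ` sphere 0 1 = e ` (cball 0 1 - ball 0 1)"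
    by (rule arg_cong[of _ _ "\<lambda>x. e ` x"]) auto
  also have "\<dots> = D - interior D"
    using int e inj_on_image_set_diff[OF inj, of "cball 0 1" "ball 0 1"]
    by (auto simp: homeomorphism_def)
  finally have sph: "e ` sphere 0 1 = D - interior D" .
  have cl: "closure (h ` interior D) = h ` D"
  proof
    have "compact (h ` D)" using h D(1) by (metis compact_continuous_image homeomorphism_cont1)
    then show "closure (h ` interior D) \<subseteq> h ` D"
      by (meson closure_minimal compact_imp_closed image_mono interior_subset)
    have "closure (interior D) = D"
      using D by (simp add: convex_closure_interior compact_imp_closed closure_closed)
    moreover have "h ` closure (interior D) \<subseteq> closure (h ` interior D)"
      using h calculation
      by (intro image_closure_subset[where T = "closure (h ` interior D)"] closed_closure closure_subset)
        (simp add: homeomorphism_def)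
    ultimately show "h ` D \<subseteq> closure (h ` interior D)" by simp
  qed
  have "homeomorphism (cball 0 1) (closure (h ` interior D)) (h \<circ> e) (e' \<circ> k)"
    unfolding cl using homeomorphism_compose[OF e h] .
  then show ?thesis unfolding disc_face_def
    using int sph by (intro exI[of _ "h \<circ> e"] exI[of _ "e' \<circ> k"])
      (simp only: image_comp [symmetric] simp_thms)
qed

lemma disc_face_open_connected:
  assumes "disc_face f B"
  shows "open f" "connected f" "f \<noteq> {}" "frontier f = B"
proof -
  obtain h k where h: "homeomorphism (cball (0::complex) 1) (closure f) h k" 
    and f: "h ` ball 0 1 = f" "h ` sphere 0 1 = B"
    using assms disc_face_def by auto
  have "h ` ball 0 1 = interior (closure f)"
    using homeomorphism_interior[OF h] by (simp add: interior_cball)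
  then show "open f" using f by (metis open_interior)
  then have int: "interior f = f" by (rule interior_open)
  have "continuous_on (ball 0 1) h"
    using h by (meson ball_subset_cball continuous_on_subset homeomorphism_def)
  then show "connected f" using f connected_continuous_image by blast
  show "f \<noteq> {}" using f by auto
  have inj: "inj_on h (cball 0 1)" using h by (metis homeomorphism_def inj_on_inverseI)
  have "B = h ` (cball 0 1 - ball 0 1)" 
    unfolding f(2)[symmetric] by (rule arg_cong[of _ _ "\<lambda>x. h ` x"]) auto
  also have "\<dots> = closure f - f"
    using h f(1) inj_on_image_set_diff[OF inj, of "cball 0 1" "ball 0 1"]
    by (auto simp: homeomorphism_def)
  finally show "frontier f = B" by (simp add: frontier_def int)
qed

text \<open>This is how the combinatorial order of the vertices on a face boundary enters without any
  angles: a boundary arc between the ends of a chord, stripped of its ends, is connected and does not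
  meet the line through the chord.\<close>

lemma connected_arc_on_one_side:
  fixes a b n :: complex
  assumes ab: "norm a = 1" "norm b = 1" "a \<noteq> b" and n: "n \<noteq> 0" "inner n a = t" "inner n b = t"
    and C: "connected C" "C \<subseteq> sphere 0 1 - {a, b}"
  shows "C \<subseteq> {z. t < inner n z} \<or> C \<subseteq> {z. inner n z < t}"
proof (rule ccontr)
  assume "\<not> ?thesis"
  then obtain x y where "x \<in> C" "y \<in> C" "inner n x \<le> t" "t \<le> inner n y"
    by (auto simp: subset_iff not_less)
  then obtain z where z: "z \<in> C" "inner n z = t"
    using connected_ivt_hyperplane[OF C(1)] by blast
  then have "z \<in> closed_segment a b"
    unfolding chord_eq_segment[OF ab n, symmetric] using C(2) by auto
  moreover have "z \<noteq> a" "z \<noteq> b" "norm z = 1" using z C(2) by auto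
  ultimately have "z \<in> open_segment a b" by (simp add: open_segment_def)
  from dist_decreases_open_segment[OF this, of 0] show False
    using ab \<open>norm z = 1\<close> by simp
qed

lemma circle_crosses_line:
  fixes a b n :: complex
  assumes ab: "norm a = 1" "norm b = 1" "a \<noteq> b" and n: "n \<noteq> 0" "inner n a = t" "inner n b = t"
  shows "norm (midpoint a b) < 1" "inner n (midpoint a b) = t" "\<exists>z\<in>sphere 0 1. t < inner n z"
proof -
  have "midpoint a b \<in> open_segment a b" using ab(3) by simp
  from dist_decreases_open_segment[OF this, of 0] ab show 1: "norm (midpoint a b) < 1" by simp
  show 2: "inner n (midpoint a b) = t"
    using n by (simp add: midpoint_def inner_add_right)
  have "t \<le> norm n * norm (midpoint a b)" unfolding 2[symmetric] by (rule norm_cauchy_schwarz)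
  also have "\<dots> < norm n" using 1 n(1) by simp
  also have "norm n = inner n (sgn n)"
    using n(1) by (simp add: sgn_div_norm power2_norm_eq_inner[symmetric] field_simps power2_eq_square)
  finally show "\<exists>z\<in>sphere 0 1. t < inner n z"
    using n(1) by (intro bexI[of _ "sgn n"]) (auto simp: norm_sgn)
qed

lemma half_disc:
  fixes a b n :: complex
  assumes ab: "norm a = 1" "norm b = 1" "a \<noteq> b" and n: "n \<noteq> 0" "inner n a = t" "inner n b = t"
  defines "D \<equiv> cball 0 1 \<inter> {z. t \<le> inner n z}"
  shows "compact D" "convex D" "interior D \<noteq> {}" "interior D = ball 0 1 \<inter> {z. t < inner n z}"
    "D - interior D = (sphere 0 1 \<inter> {z. t < inner n z}) \<union> closed_segment a b"
proof -
  show "compact D" unfolding D_def by (intro compact_Int_closed compact_cball closed_halfspace_ge)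
  show "convex D" unfolding D_def by (intro convex_Int convex_cball convex_halfspace_ge)
  show int: "interior D = ball 0 1 \<inter> {z. t < inner n z}"
    unfolding D_def by (rule half_disc_interior[OF n(1)])
  define m where "m = midpoint a b"
  have m: "norm m < 1" "inner n m = t"
    using circle_crosses_line[OF ab n] by (auto simp: m_def)
  define e where "e = (1 - norm m) / (2 * norm n)"
  have e: "e > 0" "e * norm n < 1 - norm m" using m n(1) by (auto simp: e_def field_simps)
  have "norm (m + e *\<^sub>R n) < 1" 
    using norm_triangle_ineq[of m "e *\<^sub>R n"] e by simp
  moreover have "inner n (m + e *\<^sub>R n) > t"
    using m e n(1) by (simp add: inner_add_right)
  ultimately have "m + e *\<^sub>R n \<in> interior D" unfolding int by simp
  then show "interior D \<noteq> {}" by blast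
  show "D - interior D = (sphere 0 1 \<inter> {z. t < inner n z}) \<union> closed_segment a b"
    unfolding int unfolding chord_eq_segment[OF ab n, symmetric] D_def by auto
qed

text \<open>The boundary curve of the face consists of two arcs \<open>P\<close> and \<open>Q\<close> with common ends \<open>a\<close> and \<open>b\<close>.
  Their preimages under the model homeomorphism are the two arcs into which the ends of the
  chord divide the circle, so each of the two half discs has exactly one of them on its boundary.\<close>

lemma disc_face_split:
  assumes f: "disc_face f (P \<union> Q)" and PQ: "P \<inter> Q = {a, b}" and "a \<noteq> b"
    and conn: "connected (P - {a, b})" "connected (Q - {a, b})"
  obtains \<gamma> f1 f2 where "arc \<gamma>" "pathstart \<gamma> = a" "pathfinish \<gamma> = b" "\<gamma> ` {0<..<1} \<subseteq> f"
    "disc_face f1 (P \<union> path_image \<gamma>)" "disc_face f2 (Q \<union> path_image \<gamma>)"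
    "f1 \<inter> f2 = {}" "f - path_image \<gamma> = f1 \<union> f2"
proof -
  obtain h k where h: "homeomorphism (cball (0::complex) 1) (closure f) h k"
    and hf: "h ` ball 0 1 = f" "h ` sphere 0 1 = P \<union> Q"
    using f disc_face_def by auto
  have hk: "h (k y) = y" "k y \<in> cball 0 1" if "y \<in> closure f" for y
    using h that by (auto simp: homeomorphism_def)
  have kh: "k (h x) = x" if "norm x \<le> 1" for x
    using h that by (auto simp: homeomorphism_def)
  have ks: "k ` (P \<union> Q) = sphere 0 1"
    unfolding hf(2)[symmetric] using kh by (force simp: image_iff)
  have sub: "P \<union> Q \<subseteq> closure f" 
    using h unfolding hf(2)[symmetric] homeomorphism_def by auto
  define \<alpha> \<beta> where "\<alpha> = k a" and "\<beta> = k b"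
  have abPQ: "a \<in> P" "a \<in> Q" "b \<in> P" "b \<in> Q" using PQ by auto
  have h\<alpha>: "h \<alpha> = a" "h \<beta> = b" using hk(1) sub abPQ by (auto simp: \<alpha>_def \<beta>_def)
  have ab: "norm \<alpha> = 1" "norm \<beta> = 1" using ks abPQ by (auto simp: \<alpha>_def \<beta>_def)
  have ne: "\<alpha> \<noteq> \<beta>" using h\<alpha> \<open>a \<noteq> b\<close> by auto
  have injk: "inj_on k (closure f)" by (metis hk(1) inj_on_inverseI)
  define P' Q' where "P' = k ` (P - {a, b})" and "Q' = k ` (Q - {a, b})"
  have ck: "continuous_on (closure f) k" using h by (simp add: homeomorphism_def)
  have P': "connected P'" "P' \<subseteq> sphere 0 1 - {\<alpha>, \<beta>}" and Q': "connected Q'" "Q' \<subseteq> sphere 0 1 - {\<alpha>, \<beta>}"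
  proof -
    show "connected P'" "connected Q'" unfolding P'_def Q'_def
      using conn sub by (auto intro!: connected_continuous_image continuous_on_subset[OF ck])
    have "k y \<noteq> \<alpha> \<and> k y \<noteq> \<beta>" if "y \<in> P \<union> Q - {a, b}" for y
    proof -
      have "h (k y) = y" using hk(1) sub that by blast
      then show ?thesis using that h\<alpha> by auto
    qed
    then show "P' \<subseteq> sphere 0 1 - {\<alpha>, \<beta>}" "Q' \<subseteq> sphere 0 1 - {\<alpha>, \<beta>}" 
      unfolding P'_def Q'_def using ks by blast+
  qed
  have PQ': "P' \<union> Q' \<union> {\<alpha>, \<beta>} = sphere 0 1"
  proof -
    have "P \<union> Q = (P - {a, b}) \<union> (Q - {a, b}) \<union> {a, b}" using abPQ by auto
    then have "k ` (P \<union> Q) = P' \<union> Q' \<union> {\<alpha>, \<beta>}" unfolding P'_def Q'_def \<alpha>_def \<beta>_def by blast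
    then show ?thesis using ks by simp
  qed
  \<comment> \<open>Choose the sign of the normal of the chord such that \<open>P\<close> lies on its positive side.\<close>
  have "\<exists>n. n \<noteq> 0 \<and> inner n \<alpha> = inner n \<beta> \<and> P' \<subseteq> {z. inner n \<alpha> < inner n z}"
  proof -
    define n where "n = \<i> * (\<beta> - \<alpha>)"
    have n: "n \<noteq> 0" "inner n \<alpha> = inner n \<beta>" using ne
      by (auto simp: n_def inner_complex_def algebra_simps)
    have "P' \<subseteq> {z. inner n \<beta> < inner n z} \<or> P' \<subseteq> {z. inner n z < inner n \<beta>}"
      using connected_arc_on_one_side[OF ab ne n refl P'] .
    then show ?thesis
    proof
      assume "P' \<subseteq> {z. inner n \<beta> < inner n z}"
      then show ?thesis using n by (intro exI[of _ n]) simp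
    next
      assume "P' \<subseteq> {z. inner n z < inner n \<beta>}"
      then show ?thesis using n by (intro exI[of _ "- n"]) auto
    qed
  qed
  then obtain n where n0: "n \<noteq> 0" and nb: "inner n \<alpha> = inner n \<beta>" 
    and P'side: "P' \<subseteq> {z. inner n \<alpha> < inner n z}" by blast
  define t where "t = inner n \<alpha>"
  have n: "n \<noteq> 0" "inner n \<alpha> = t" "inner n \<beta> = t" using n0 nb by (auto simp: t_def)
  have n': "- n \<noteq> 0" "inner (- n) \<alpha> = - t" "inner (- n) \<beta> = - t" using n by auto
  have Pt: "P' \<subseteq> {z. t < inner n z}" using P'side by (simp add: t_def)
  \<comment> \<open>If \<open>Q\<close> were on the same side as \<open>P\<close>, the points of the circle on the other side would be uncovered.\<close>
  have Qt: "Q' \<subseteq> {z. inner n z < t}"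
  proof (rule ccontr)
    assume "\<not> ?thesis"
    then have "Q' \<subseteq> {z. t < inner n z}"
      using connected_arc_on_one_side[OF ab ne n Q'] by blast
    moreover obtain z where "z \<in> sphere 0 1" "- t < inner (- n) z"
      using circle_crosses_line(3)[OF ab ne n'] by blast
    moreover have "z \<in> P' \<union> Q' \<union> {\<alpha>, \<beta>}" unfolding PQ' by fact
    ultimately show False using Pt n by auto
  qed
  have P'_eq: "sphere 0 1 \<inter> {z. t < inner n z} = P'" unfolding PQ'[symmetric] using P' Pt Qt n by auto
  have Q'_eq: "sphere 0 1 \<inter> {z. - t < inner (- n) z} = Q'" unfolding PQ'[symmetric] using Q' Pt Qt n by auto
  define D1 D2 where "D1 = cball 0 1 \<inter> {z. t \<le> inner n z}"
    and "D2 = cball 0 1 \<inter> {z. - t \<le> inner (- n) z}"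
  note D1 = half_disc[OF ab ne n, folded D1_def]
  note D2 = half_disc[OF ab ne n', folded D2_def]
  define \<gamma> where "\<gamma> = h \<circ> linepath \<alpha> \<beta>"
  have seg: "closed_segment \<alpha> \<beta> \<subseteq> cball 0 1" 
    using ab by (intro closed_segment_subset) auto
  have oseg: "open_segment \<alpha> \<beta> \<subseteq> ball 0 1" 
    using dist_decreases_open_segment[of _ \<alpha> \<beta> 0] ab by auto
  have img: "path_image \<gamma> = h ` closed_segment \<alpha> \<beta>" by (simp add: \<gamma>_def path_image_compose)
  have injh: "inj_on h (cball 0 1)" by (rule inj_on_inverseI[of _ k]) (use kh in auto)
  have ch: "continuous_on (cball 0 1) h" using h by (simp add: homeomorphism_def)
  have "arc \<gamma>"
  proof -
    have "linepath \<alpha> \<beta> ` {0..1} \<subseteq> cball 0 1"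
      using seg by (metis path_image_def path_image_linepath)
    then show ?thesis
      using arc_linepath[OF ne] unfolding arc_def \<gamma>_def
      by (intro conjI path_continuous_image comp_inj_on continuous_on_subset[OF ch] inj_on_subset[OF injh])
        (auto simp: path_image_def)
  qed
  moreover have "pathstart \<gamma> = a" "pathfinish \<gamma> = b" 
    by (auto simp: \<gamma>_def pathstart_compose pathfinish_compose h\<alpha>)
  moreover have "\<gamma> ` {0<..<1} \<subseteq> f"
  proof -
    have "linepath \<alpha> \<beta> s \<in> open_segment \<alpha> \<beta>" if "0 < s" "s < 1" for s
      using that ne by (auto simp: linepath_def in_segment)
    then have "linepath \<alpha> \<beta> ` {0<..<1} \<subseteq> ball 0 1" using oseg by auto
    then show ?thesis unfolding \<gamma>_def hf(1)[symmetric] image_comp [symmetric] by (rule image_mono)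
  qed
  moreover have 
    "disc_face (h ` interior D1) (P \<union> path_image \<gamma>)" "disc_face (h ` interior D2) (Q \<union> path_image \<gamma>)"
  proof -
    have hkX: "h ` k ` X = X" if "X \<subseteq> closure f" for X
    proof -
      have "h ` k ` X = (\<lambda>x. x) ` X"
        unfolding image_image using hk(1) that by (intro image_cong) auto
      then show ?thesis by simp
    qed
    have "P - {a, b} \<subseteq> closure f" "Q - {a, b} \<subseteq> closure f" using sub by auto
    from this[THEN hkX] have hP: "h ` P' = P - {a, b}" "h ` Q' = Q - {a, b}"
      unfolding P'_def Q'_def .
    have a: "a \<in> path_image \<gamma>" "b \<in> path_image \<gamma>"
      using h\<alpha> unfolding img by auto
    have "homeomorphism D1 (h ` D1) h k" "homeomorphism D2 (h ` D2) h k"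
      by (rule homeomorphism_of_subsets[OF h _ order_refl refl], simp add: D1_def D2_def)+
    from this[THEN disc_face_convex_image]
    have "disc_face (h ` interior D1) (h ` (D1 - interior D1))" 
      "disc_face (h ` interior D2) (h ` (D2 - interior D2))" using D1(1-3) D2(1-3) by auto
    moreover have "h ` (D1 - interior D1) = P \<union> path_image \<gamma>"
      unfolding D1(5) P'_eq image_Un hP img[symmetric] using a by auto
    moreover have "h ` (D2 - interior D2) = Q \<union> path_image \<gamma>"
      unfolding D2(5) Q'_eq image_Un hP img[symmetric] using a by auto
    ultimately show "disc_face (h ` interior D1) (P \<union> path_image \<gamma>)" 
      "disc_face (h ` interior D2) (Q \<union> path_image \<gamma>)" by simp_all
  qed
  moreover have "h ` interior D1 \<inter> h ` interior D2 = {}"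
    unfolding D1(4) D2(4) 
    by (subst inj_on_image_Int[OF injh, symmetric]) auto
  moreover have "f - path_image \<gamma> = h ` interior D1 \<union> h ` interior D2"
  proof -
    have "f - path_image \<gamma> = h ` (ball 0 1 - closed_segment \<alpha> \<beta>)"
      unfolding hf(1)[symmetric] img using seg
      by (subst inj_on_image_set_diff[OF injh]) auto
    also have "ball 0 1 - closed_segment \<alpha> \<beta> = interior D1 \<union> interior D2"
      unfolding D1(4) D2(4) chord_eq_segment[OF ab ne n, symmetric] by auto
    finally show ?thesis by (simp add: image_Un)
  qed
  ultimately show thesis using that by blast
qed

section \<open>Plane drawings with disc faces\<close>

fun path_edges :: "'a list \<Rightarrow> 'a set set" where
  "path_edges (x # y # zs) = insert {x, y} (path_edges (y # zs))"
| "path_edges _ = {}"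

definition cycle_edges :: "'a list \<Rightarrow> 'a set set" where
  "cycle_edges c = path_edges (c @ [hd c])"

definition edges_image :: "('a set \<Rightarrow> real \<Rightarrow> complex) \<Rightarrow> 'a set set \<Rightarrow> complex set" where
  "edges_image g A = (\<Union>e\<in>A. path_image (g e))"

definition facial_cycle :: "'a set set \<Rightarrow> 'a list \<Rightarrow> bool" where
  "facial_cycle E c \<longleftrightarrow> 3 \<le> length c \<and> distinct c \<and> cycle_edges c \<subseteq> E"

text \<open>The invariant of the construction: \<open>O'\<close> is the outer face, and the lists \<open>cs\<close> and \<open>fs\<close> pair every
  bounded face with the cycle of vertices around it. The faces are given as disjoint connected open
  sets that cover the complement of the drawing, which determines them as its components.\<close>

definition plane_drawing where
  "plane_drawing V E cs p g O' fs \<longleftrightarrow> planar_embedding V E p g \<and>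
     open O' \<and> connected O' \<and> O' \<noteq> {} \<and> triangular_face E g O' \<and>
     sorted_wrt disjnt (O' # fs) \<and> O' \<union> \<Union>(set fs) = - (p ` V \<union> edges_image g E) \<and>
     list_all2 (\<lambda>c f. facial_cycle E c \<and> disc_face f (edges_image g (cycle_edges c))) cs fs"

definition plane_map :: "'a set \<Rightarrow> 'a set set \<Rightarrow> 'a list list \<Rightarrow> bool" where
  "plane_map V E cs \<longleftrightarrow> simple_graph V E \<and> (\<exists>p g O' fs. plane_drawing V E cs p g O' fs)"

lemma path_edges_append:
  "path_edges (xs @ y # zs) = path_edges (xs @ [y]) \<union> path_edges (y # zs)"
  by (induction xs rule: path_edges.induct) auto

lemma path_edges_subset: "e \<in> path_edges xs \<Longrightarrow> e \<subseteq> set xs"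
  by (induction xs rule: path_edges.induct) auto

lemma Union_path_edges: "\<Union>(path_edges (x # y # zs)) = set (x # y # zs)"
  by (induction zs arbitrary: x y) auto

lemma path_vertices: "\<Union>(path_edges (u # ps @ [v])) = insert u (insert v (set ps))"
  using Union_path_edges[of u "hd (ps @ [v])" "tl (ps @ [v])"] by auto

lemma cycle_edges_split:
  "cycle_edges (u # ps @ v # qs) = path_edges (u # ps @ [v]) \<union> path_edges (v # qs @ [u])"
  using path_edges_append[of "u # ps" v "qs @ [u]"] by (simp add: cycle_edges_def)

lemma cycle_edges_rotate1: "cycle_edges (rotate1 c) = cycle_edges c"
proof (cases c)
  case (Cons x xs)
  then show ?thesis
  proof (cases xs)
    case (Cons y ys)
    have "path_edges ((y # ys) @ [x, y]) = path_edges (y # ys @ [x]) \<union> {{x, y}}"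
      using path_edges_append[of "y # ys" x "[y]"] by simp
    with Cons \<open>c = _\<close> show ?thesis by (auto simp: cycle_edges_def)
  qed (auto simp: cycle_edges_def)
qed (auto simp: cycle_edges_def)

lemma edges_image_Un: "edges_image g (A \<union> B) = edges_image g A \<union> edges_image g B"
  by (auto simp: edges_image_def)

lemma edges_image_insert: "edges_image g (insert e A) = path_image (g e) \<union> edges_image g A"
  by (auto simp: edges_image_def)

lemma edges_image_cong: "(\<And>e. e \<in> A \<Longrightarrow> g e = g' e) \<Longrightarrow> edges_image g A = edges_image g' A"
  by (auto simp: edges_image_def)

lemma path_image_open_arc:
  "path_image \<gamma> = \<gamma> ` {0<..<1} \<union> {pathstart \<gamma>, pathfinish \<gamma>}"
proof -
  have "{0..1} = {0<..<1} \<union> {0, 1 :: real}" by auto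
  then show ?thesis by (auto simp: path_image_def pathstart_def pathfinish_def)
qed

context
  fixes V E p g
  assumes sg: "simple_graph V E" and emb: "planar_embedding V E p g"
begin

lemma edge_image: "e \<in> E \<Longrightarrow> path_image (g e) = g e ` {0<..<1} \<union> p ` e"
  using emb path_image_open_arc[of "g e"] by (auto simp: planar_embedding_def)

lemma open_edge_no_vertex: "e \<in> E \<Longrightarrow> v \<in> V \<Longrightarrow> p v \<notin> g e ` {0<..<1}"
  using emb by (auto simp: planar_embedding_def)

lemma edge_in: "e \<in> E \<Longrightarrow> e \<subseteq> V"
  using sg by (auto simp: simple_graph_def)

lemma edge_images_inter:
  assumes "e \<in> E" "e' \<in> E" "e \<noteq> e'"
  shows "path_image (g e) \<inter> path_image (g e') = p ` (e \<inter> e')"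
proof -
  have disj: "g e ` {0<..<1} \<inter> path_image (g e') = {}" "g e' ` {0<..<1} \<inter> path_image (g e) = {}"
    using emb assms unfolding planar_embedding_def by metis+
  have sets: "(A \<union> B) \<inter> (C \<union> D) = B \<inter> D" if "A \<inter> (C \<union> D) = {}" "C \<inter> (A \<union> B) = {}"
    for A B C D :: "complex set" using that by blast
  have "path_image (g e) \<inter> path_image (g e') = p ` e \<inter> p ` e'"
    using disj unfolding edge_image[OF assms(1)] edge_image[OF assms(2)] by (rule sets)
  also have "p ` e \<inter> p ` e' = p ` (e \<inter> e')"
    using emb edge_in assms by (intro inj_on_image_Int[symmetric, where C = V]) (auto simp: planar_embedding_def)
  finally show ?thesis .
qed

lemma vertex_closure_open_edge:
  assumes "e \<in> E" "v \<in> e"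
  shows "p v \<in> closure (g e ` {0<..<1})"
proof -
  have "continuous_on (closure {0<..<1}) (g e)"
    using emb assms by (auto simp: planar_embedding_def arc_def path_def)
  then have "g e ` closure {0<..<1} \<subseteq> closure (g e ` {0<..<1})"
    by (intro image_closure_subset closed_closure closure_subset)
  moreover have "p v \<in> g e ` closure {0<..<1}"
    using edge_image[OF assms(1)] assms(2) by (auto simp: path_image_def)
  ultimately show ?thesis by blast
qed

text \<open>The open edges of a path are connected and each inner vertex lies in the closure of the open
  edges next to it, so they can be glued together at the inner vertices one after the other.\<close>

lemma connected_path_interior_aux:
  assumes "path_edges (u # ps @ [v]) \<subseteq> E"
  shows "connected ((\<Union>e\<in>path_edges (u # ps @ [v]). g e ` {0<..<1}) \<union> p ` set ps)"
  using assms
proof (induction ps arbitrary: u)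
  case Nil
  then have "continuous_on {0<..<1} (g {u, v})"
    using emb by (auto simp: planar_embedding_def arc_def path_def intro: continuous_on_subset)
  then show ?case by (auto intro: connected_continuous_image)
next
  case (Cons y ps)
  let ?J = "(\<Union>e\<in>path_edges (y # ps @ [v]). g e ` {0<..<1}) \<union> p ` set ps"
  let ?o = "g {u, y} ` {0<..<1}"
  have uy: "{u, y} \<in> E" using Cons.prems by simp
  have "continuous_on {0<..<1} (g {u, y})"
    using emb uy by (auto simp: planar_embedding_def arc_def path_def intro: continuous_on_subset)
  then have "connected ?o" by (rule connected_continuous_image) simp
  moreover have "insert (p y) ?o \<subseteq> closure ?o"
    using vertex_closure_open_edge[OF uy, of y] closure_subset[of ?o] by simp
  ultimately have 1: "connected (insert (p y) ?o)"
    by (rule connected_intermediate_closure[OF _ subset_insertI])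
  obtain e where e: "e \<in> path_edges (y # ps @ [v])" "y \<in> e"
    by (cases ps) auto
  have J: "connected ?J" using Cons by simp
  have "p y \<in> closure ?J"
  proof -
    have "e \<in> E" using e(1) Cons.prems by auto
    moreover have "g e ` {0<..<1} \<subseteq> ?J" using e(1) by blast
    ultimately show ?thesis using vertex_closure_open_edge[of e y] e(2) closure_mono by blast
  qed
  then have "insert (p y) ?J \<subseteq> closure ?J" using closure_subset[of ?J] by simp
  then have 2: "connected (insert (p y) ?J)"
    by (rule connected_intermediate_closure[OF J subset_insertI])
  have "connected (insert (p y) ?o \<union> insert (p y) ?J)"
    using 1 2 by (rule connected_Un) blast
  moreover have "insert (p y) ?o \<union> insert (p y) ?J =
    (\<Union>e\<in>path_edges (u # (y # ps) @ [v]). g e ` {0<..<1}) \<union> p ` set (y # ps)" by auto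
  ultimately show ?case by simp
qed

lemma path_edges_image:
  assumes "path_edges (u # ps @ [v]) \<subseteq> E"
  shows "edges_image g (path_edges (u # ps @ [v])) =
    (\<Union>e\<in>path_edges (u # ps @ [v]). g e ` {0<..<1}) \<union> p ` (set ps \<union> {u, v})"
proof -
  let ?A = "path_edges (u # ps @ [v])"
  have "edges_image g ?A = (\<Union>e\<in>?A. g e ` {0<..<1} \<union> p ` e)"
    unfolding edges_image_def using assms edge_image by (intro SUP_cong) auto
  also have "\<dots> = (\<Union>e\<in>?A. g e ` {0<..<1}) \<union> p ` \<Union>?A"
    by (simp add: UN_Un_distrib image_Union)
  finally have "edges_image g ?A = (\<Union>e\<in>?A. g e ` {0<..<1}) \<union> p ` \<Union>?A" .
  moreover have "\<Union>?A = set ps \<union> {u, v}"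
    by (auto simp: path_vertices)
  ultimately show ?thesis by simp
qed

lemma connected_path_interior:
  assumes "path_edges (u # ps @ [v]) \<subseteq> E" "distinct (u # ps @ [v])"
  shows "connected (edges_image g (path_edges (u # ps @ [v])) - {p u, p v})"
proof -
  let ?A = "path_edges (u # ps @ [v])"
  have "\<Union>?A \<subseteq> V" using edge_in assms(1) by (meson Union_least subsetD)
  then have sub: "set (u # ps @ [v]) \<subseteq> V" unfolding path_vertices by simp
  then have 1: "p u \<notin> p ` set ps" "p v \<notin> p ` set ps"
    using emb assms(2) by (auto simp: planar_embedding_def inj_on_def)
  have 2: "p w \<notin> (\<Union>e\<in>?A. g e ` {0<..<1})" if "w \<in> {u, v}" for w
  proof
    assume "p w \<in> (\<Union>e\<in>?A. g e ` {0<..<1})"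
    then obtain e where "e \<in> ?A" "p w \<in> g e ` {0<..<1}" by (elim UN_E)
    moreover have "w \<in> V" using that sub by auto
    ultimately show False using open_edge_no_vertex[of e w] assms(1) by (meson subsetD)
  qed
  have "edges_image g ?A - {p u, p v} = (\<Union>e\<in>?A. g e ` {0<..<1}) \<union> p ` set ps"
    unfolding path_edges_image[OF assms(1)] using 1 2[of u] 2[of v] by (simp add: Un_Diff image_Un)
  then show ?thesis using connected_path_interior_aux[OF assms(1)] by simp
qed

text \<open>Edges of a plane drawing meet only in common end vertices, and the two paths have only \<open>u\<close> and \<open>v\<close>
  in common. They could share the edge \<open>{u, v}\<close> only if both were that single edge.\<close>

lemma two_paths_inter:
  assumes "path_edges (u # ps @ [v]) \<subseteq> E" "path_edges (v # qs @ [u]) \<subseteq> E"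
    and "distinct (u # ps @ v # qs)" "ps \<noteq> [] \<or> qs \<noteq> []"
  shows "edges_image g (path_edges (u # ps @ [v])) \<inter> edges_image g (path_edges (v # qs @ [u])) = {p u, p v}"
proof
  show "{p u, p v} \<subseteq> edges_image g (path_edges (u # ps @ [v])) \<inter> edges_image g (path_edges (v # qs @ [u]))"
    using assms by (auto simp: path_edges_image)
  show "edges_image g (path_edges (u # ps @ [v])) \<inter> edges_image g (path_edges (v # qs @ [u])) \<subseteq> {p u, p v}"
  proof
    fix z assume "z \<in> edges_image g (path_edges (u # ps @ [v])) \<inter> edges_image g (path_edges (v # qs @ [u]))"
    then obtain e e' where e: "e \<in> path_edges (u # ps @ [v])" "z \<in> path_image (g e)"
      and e': "e' \<in> path_edges (v # qs @ [u])" "z \<in> path_image (g e')"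
      by (auto simp: edges_image_def)
    have sub: "e \<subseteq> set (u # ps @ [v])" "e' \<subseteq> set (v # qs @ [u])"
      using e e' path_edges_subset by blast+
    then have int: "e \<inter> e' \<subseteq> {u, v}" using assms(3) by auto
    have "e \<noteq> e'"
    proof
      assume "e = e'"
      then have "e \<subseteq> {u, v}" using int by auto
      moreover have "card e = 2" using sg e(1) assms(1) by (auto simp: simple_graph_def)
      moreover have "u \<noteq> v" using assms(3) by auto
      ultimately have "e = {u, v}" using card_subset_eq[of "{u, v}" e] by simp
      then have *: "{u, v} \<in> path_edges (u # ps @ [v])" "{u, v} \<in> path_edges (v # qs @ [u])"
        using e e' \<open>e = e'\<close> by auto
      have "ps = []"
      proof (cases ps)
        case (Cons y ys)
        then have "{u, v} \<in> path_edges (y # ys @ [v])"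
          using *(1) assms(3) by (auto simp: doubleton_eq_iff)
        then have "u \<in> set (y # ys @ [v])" using path_edges_subset by blast
        then show ?thesis using assms(3) Cons by auto
      qed
      moreover have "qs = []"
      proof (cases qs)
        case (Cons y ys)
        then have "{u, v} \<in> path_edges (y # ys @ [u])"
          using *(2) assms(3) by (auto simp: doubleton_eq_iff)
        then have "v \<in> set (y # ys @ [u])" using path_edges_subset by blast
        then show ?thesis using assms(3) Cons by auto
      qed
      ultimately show False using assms(4) by auto
    qed
    then have "path_image (g e) \<inter> path_image (g e') = p ` (e \<inter> e')"
      using e(1) e'(1) assms(1,2) by (intro edge_images_inter) auto
    then have "z \<in> p ` (e \<inter> e')" using e(2) e'(2) by blast
    then show "z \<in> {p u, p v}" using int by auto
  qed
qed

end

section \<open>Adding edges and vertices inside a face\<close>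

lemma plane_drawing_head:
  assumes "plane_drawing V E (c # cs) p g O' fs"
  obtains f fs' where "fs = f # fs'" "facial_cycle E c" "disc_face f (edges_image g (cycle_edges c))"
    "list_all2 (\<lambda>c f. facial_cycle E c \<and> disc_face f (edges_image g (cycle_edges c))) cs fs'"
proof -
  have "list_all2 (\<lambda>c f. facial_cycle E c \<and> disc_face f (edges_image g (cycle_edges c))) (c # cs) fs"
    using assms unfolding plane_drawing_def by blast
  then show thesis using that unfolding list_all2_Cons1 by blast
qed

lemma disjoint_subset: "A \<inter> B = {} \<Longrightarrow> C \<subseteq> B \<Longrightarrow> A \<inter> C = {}"
  by blast

text \<open>One of the two operations that build all drawings below is to draw an edge across a face; the
  other one subdivides such an edge by a new vertex. Both start from this arc.\<close>

lemma plane_drawing_split: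
  assumes sg: "simple_graph V E" and d: "plane_drawing V E ((u # ps @ v # qs) # cs) p g O' fs"
  obtains \<gamma> f1 f2 fs' where "arc \<gamma>" "pathstart \<gamma> = p u" "pathfinish \<gamma> = p v"
    "\<gamma> ` {0<..<1} \<inter> (p ` V \<union> edges_image g E) = {}"
    "disc_face f1 (edges_image g (path_edges (u # ps @ [v])) \<union> path_image \<gamma>)"
    "disc_face f2 (edges_image g (path_edges (v # qs @ [u])) \<union> path_image \<gamma>)"
    "sorted_wrt disjnt (O' # f1 # f2 # fs')"
    "O' \<union> \<Union>(set (f1 # f2 # fs')) = - (p ` V \<union> edges_image g E \<union> path_image \<gamma>)"
    "list_all2 (\<lambda>c f. facial_cycle E c \<and> disc_face f (edges_image g (cycle_edges c))) cs fs'"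
proof -
  note d' = d[unfolded plane_drawing_def]
  then have emb: "planar_embedding V E p g" by blast
  obtain f fs' where fs: "fs = f # fs'" and fc: "facial_cycle E (u # ps @ v # qs)"
    and df: "disc_face f (edges_image g (cycle_edges (u # ps @ v # qs)))"
    and rest: "list_all2 (\<lambda>c f. facial_cycle E c \<and> disc_face f (edges_image g (cycle_edges c))) cs fs'"
    using plane_drawing_head[OF d] by blast
  let ?P = "edges_image g (path_edges (u # ps @ [v]))" and ?Q = "edges_image g (path_edges (v # qs @ [u]))"
  have E: "path_edges (u # ps @ [v]) \<subseteq> E" "path_edges (v # qs @ [u]) \<subseteq> E"
    and dist: "distinct (u # ps @ v # qs)" and ne: "ps \<noteq> [] \<or> qs \<noteq> []"
    using fc by (auto simp: facial_cycle_def cycle_edges_split)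
  have uv: "u \<in> V" "v \<in> V" "u \<noteq> v"
  proof -
    have "\<Union>(path_edges (u # ps @ [v])) \<subseteq> V"
      using E sg by (meson Union_least simple_graph_def subsetD)
    then show "u \<in> V" "v \<in> V" unfolding path_vertices by auto
    show "u \<noteq> v" using dist by auto
  qed
  have "p u \<noteq> p v" using emb uv by (auto simp: planar_embedding_def inj_on_def)
  have 1: "?P \<inter> ?Q = {p u, p v}" using two_paths_inter[OF sg emb E dist ne] .
  have 2: "connected (?P - {p u, p v})" "connected (?Q - {p u, p v})"
    using connected_path_interior[OF sg emb, of u ps v] connected_path_interior[OF sg emb, of v qs u] E dist
    by (auto simp: insert_commute)
  have "disc_face f (?P \<union> ?Q)" using df by (simp add: cycle_edges_split edges_image_Un)
  from disc_face_split[OF this 1 \<open>p u \<noteq> p v\<close> 2]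
  obtain \<gamma> f1 f2 where \<gamma>: "arc \<gamma>" "pathstart \<gamma> = p u" "pathfinish \<gamma> = p v" "\<gamma> ` {0<..<1} \<subseteq> f"
    and f12: "disc_face f1 (?P \<union> path_image \<gamma>)" "disc_face f2 (?Q \<union> path_image \<gamma>)"
      "f1 \<inter> f2 = {}" "f - path_image \<gamma> = f1 \<union> f2" by metis
  have cover: "O' \<union> (f \<union> \<Union>(set fs')) = - (p ` V \<union> edges_image g E)"
    and sorted: "sorted_wrt disjnt (O' # f # fs')" using d' fs by auto
  have open_arc: "\<gamma> ` {0<..<1} \<inter> (p ` V \<union> edges_image g E) = {}" using \<gamma>(4) cover by blast
  have img: "path_image \<gamma> = \<gamma> ` {0<..<1} \<union> {p u, p v}" using path_image_open_arc[of \<gamma>] \<gamma> by simp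
  then have away: "path_image \<gamma> \<inter> (O' \<union> \<Union>(set fs')) = {}"
  proof -
    have "f \<inter> (O' \<union> \<Union>(set fs')) = {}" using sorted by (auto simp: disjnt_def)
    moreover have "{p u, p v} \<inter> (O' \<union> \<Union>(set fs')) = {}" using cover uv by blast
    ultimately show ?thesis using \<gamma>(4) unfolding img by blast
  qed
  have "f1 \<subseteq> f" "f2 \<subseteq> f" using f12 by auto
  then have "sorted_wrt disjnt (O' # f1 # f2 # fs')" using sorted f12(3)
    by (auto simp: disjnt_def[of f1 f2] intro: disjnt_subset1 disjnt_subset2)
  moreover have "O' \<union> \<Union>(set (f1 # f2 # fs')) = - (p ` V \<union> edges_image g E \<union> path_image \<gamma>)"
  proof -
    have "O' \<union> \<Union>(set (f1 # f2 # fs')) = (O' \<union> (f \<union> \<Union>(set fs'))) - path_image \<gamma>"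
      using f12(4) away by auto
    then show ?thesis unfolding cover by auto
  qed
  ultimately show thesis using that \<gamma>(1-3) open_arc f12(1,2) rest by blast
qed

lemma list_all2_faces_mono:
  assumes "list_all2 (\<lambda>c f. facial_cycle E c \<and> disc_face f (edges_image g (cycle_edges c))) cs fs"
    and "E \<subseteq> E'" "\<And>e. e \<in> E \<Longrightarrow> g' e = g e"
  shows "list_all2 (\<lambda>c f. facial_cycle E' c \<and> disc_face f (edges_image g' (cycle_edges c))) cs fs"
  using assms(1)
proof (rule list_all2_mono)
  fix c f assume *: "facial_cycle E c \<and> disc_face f (edges_image g (cycle_edges c))"
  then have "edges_image g' (cycle_edges c) = edges_image g (cycle_edges c)"
    using assms(3) by (intro edges_image_cong) (auto simp: facial_cycle_def)
  then show "facial_cycle E' c \<and> disc_face f (edges_image g' (cycle_edges c))"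
    using * assms(2) by (auto simp: facial_cycle_def)
qed

lemma graph_cycle_triangle:
  "graph_cycle E [u, v, w] \<longleftrightarrow> distinct [u, v, w] \<and> {u, v} \<in> E \<and> {v, w} \<in> E \<and> {w, u} \<in> E"
proof -
  have "(\<forall>i<Suc (Suc (Suc 0)). P i) \<longleftrightarrow> P 0 \<and> P (Suc 0) \<and> P (Suc (Suc 0))" for P
    using less_Suc_eq by auto
  then show ?thesis unfolding graph_cycle_def list.size add_Suc_right add_0_right by simp
qed

lemma triangular_face_mono:
  assumes "triangular_face E g f" "E \<subseteq> E'" "\<And>e. e \<in> E \<Longrightarrow> g' e = g e"
  shows "triangular_face E' g' f"
proof -
  obtain u v w where c: "graph_cycle E [u, v, w]"
    and f: "frontier f = path_image (g {u, v}) \<union> path_image (g {v, w}) \<union> path_image (g {w, u})"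
    using assms(1) by (auto simp: triangular_face_def)
  have e: "{u, v} \<in> E" "{v, w} \<in> E" "{w, u} \<in> E" using c by (auto simp: graph_cycle_triangle)
  have "graph_cycle E' [u, v, w]" using c e assms(2) unfolding graph_cycle_triangle by blast
  moreover have "frontier f = path_image (g' {u, v}) \<union> path_image (g' {v, w}) \<union> path_image (g' {w, u})"
    unfolding f e[THEN assms(3)] ..
  ultimately show ?thesis unfolding triangular_face_def by blast
qed

lemma plane_map_add_chord:
  assumes pm: "plane_map V E ((u # ps @ v # qs) # cs)" and ne: "ps \<noteq> []" "qs \<noteq> []"
    and new: "{u, v} \<notin> E"
  shows "plane_map V (insert {u, v} E) ((u # ps @ [v]) # (v # qs @ [u]) # cs)"
proof -
  obtain p g O' fs where sg: "simple_graph V E" and d: "plane_drawing V E ((u # ps @ v # qs) # cs) p g O' fs"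
    using pm unfolding plane_map_def by blast
  note d' = d[unfolded plane_drawing_def]
  have emb: "planar_embedding V E p g" and tri: "triangular_face E g O'" using d' by blast+
  have fc: "facial_cycle E (u # ps @ v # qs)" using plane_drawing_head[OF d] .
  obtain \<gamma> f1 f2 fs' where \<gamma>: "arc \<gamma>" "pathstart \<gamma> = p u" "pathfinish \<gamma> = p v"
    and disj: "\<gamma> ` {0<..<1} \<inter> (p ` V \<union> edges_image g E) = {}"
    and df: "disc_face f1 (edges_image g (path_edges (u # ps @ [v])) \<union> path_image \<gamma>)"
      "disc_face f2 (edges_image g (path_edges (v # qs @ [u])) \<union> path_image \<gamma>)"
    and sorted: "sorted_wrt disjnt (O' # f1 # f2 # fs')"
    and cover: "O' \<union> \<Union>(set (f1 # f2 # fs')) = - (p ` V \<union> edges_image g E \<union> path_image \<gamma>)"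
    and rest: "list_all2 (\<lambda>c f. facial_cycle E c \<and> disc_face f (edges_image g (cycle_edges c))) cs fs'"
    using plane_drawing_split[OF sg d] .
  have E: "path_edges (u # ps @ [v]) \<subseteq> E" "path_edges (v # qs @ [u]) \<subseteq> E"
    and dist: "distinct (u # ps @ v # qs)"
    using fc by (auto simp: facial_cycle_def cycle_edges_split)
  have uv: "u \<in> V" "v \<in> V" "u \<noteq> v"
  proof -
    have "\<Union>(path_edges (u # ps @ [v])) \<subseteq> V"
      using E sg by (meson Union_least simple_graph_def subsetD)
    then show "u \<in> V" "v \<in> V" unfolding path_vertices by auto
    show "u \<noteq> v" using dist by auto
  qed
  let ?E = "insert {u, v} E" and ?g = "g({u, v} := \<gamma>)"
  have g: "?g e = g e" if "e \<in> E" for e using that new by auto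
  have img: "path_image \<gamma> = \<gamma> ` {0<..<1} \<union> {p u, p v}" using path_image_open_arc[of \<gamma>] \<gamma> by simp
  have sg': "simple_graph V ?E" using sg uv by (auto simp: simple_graph_def)
  have g_new: "?g {u, v} = \<gamma>" by simp
  have \<gamma>E: "\<gamma> ` {0<..<1} \<inter> edges_image g E = {}" using disj by (simp add: Int_Un_distrib)
  have "planar_embedding V ?E p ?g" unfolding planar_embedding_def
  proof (intro conjI ballI impI)
    show "inj_on p V" using emb by (simp add: planar_embedding_def)
  next
    fix e assume e: "e \<in> ?E"
    have all: "arc (?g e) \<and> {pathstart (?g e), pathfinish (?g e)} = p ` e \<and> ?g e ` {0<..<1} \<inter> p ` V = {}"
    proof (cases "e = {u, v}")
      case True
      have "\<gamma> ` {0<..<1} \<inter> p ` V = {}" using disj by blast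
      then show ?thesis unfolding True g_new using \<gamma> by simp
    next
      case False
      then have "e \<in> E" using e by simp
      then show ?thesis unfolding g[OF \<open>e \<in> E\<close>] using emb by (simp add: planar_embedding_def)
    qed
    show "arc (?g e)" by (rule all[THEN conjunct1])
    show "{pathstart (?g e), pathfinish (?g e)} = p ` e" by (rule all[THEN conjunct2, THEN conjunct1])
    show "?g e ` {0<..<1} \<inter> p ` V = {}" by (rule all[THEN conjunct2, THEN conjunct2])
  next
    fix e e' assume e: "e \<in> ?E" and e': "e' \<in> ?E" and ne: "e \<noteq> e'"
    have old_new: "g e ` {0<..<1} \<inter> path_image \<gamma> = {}" if "e \<in> E" for e
    proof -
      have "g e ` {0<..<1} \<subseteq> edges_image g E" using that
        by (auto simp: edges_image_def path_image_def)
      then have "g e ` {0<..<1} \<inter> \<gamma> ` {0<..<1} = {}"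
        by (subst Int_commute) (rule disjoint_subset[OF \<gamma>E])
      moreover have "p u \<notin> g e ` {0<..<1}" "p v \<notin> g e ` {0<..<1}"
        using open_edge_no_vertex[OF sg emb that] uv by simp_all
      ultimately show ?thesis unfolding img Int_Un_distrib by simp
    qed
    have new_old: "\<gamma> ` {0<..<1} \<inter> path_image (g e) = {}" if "e \<in> E" for e
    proof -
      have "path_image (g e) \<subseteq> edges_image g E" using that by (auto simp: edges_image_def)
      then show ?thesis by (rule disjoint_subset[OF \<gamma>E])
    qed
    consider "e \<in> E" "e' \<in> E" | "e \<in> E" "e' = {u, v}" | "e = {u, v}" "e' \<in> E"
      using e e' ne by blast
    then show "?g e ` {0<..<1} \<inter> path_image (?g e') = {}"
    proof cases
      case 1
      then show ?thesis using emb ne unfolding g[OF 1(1)] g[OF 1(2)] by (simp add: planar_embedding_def)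
    next
      case 2
      then show ?thesis unfolding g[OF 2(1)] 2(2) g_new by (intro old_new)
    next
      case 3
      then show ?thesis unfolding g[OF 3(2)] 3(1) g_new by (intro new_old)
    qed
  qed
  moreover have "edges_image ?g ?E = edges_image g E \<union> path_image \<gamma>"
    using edges_image_cong[of E ?g g] g by (simp add: edges_image_insert Un_commute)
  moreover have "triangular_face ?E ?g O'"
    by (rule triangular_face_mono[OF tri subset_insertI g])
  moreover have "list_all2 (\<lambda>c f. facial_cycle ?E c \<and> disc_face f (edges_image ?g (cycle_edges c))) cs fs'"
    by (rule list_all2_faces_mono[OF rest subset_insertI g])
  moreover have "facial_cycle ?E (u # ps @ [v])" "facial_cycle ?E (v # qs @ [u])"
  proof -
    have "cycle_edges (u # ps @ [v]) = insert {u, v} (path_edges (u # ps @ [v]))"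
      "cycle_edges (v # qs @ [u]) = insert {u, v} (path_edges (v # qs @ [u]))"
      using cycle_edges_split[of u ps v "[]"] cycle_edges_split[of v qs u "[]"]
      by (simp_all add: insert_commute)
    moreover have "3 \<le> length (u # ps @ [v])" "3 \<le> length (v # qs @ [u])"
      using ne by (simp_all add: Suc_le_eq)
    moreover have "distinct (u # ps @ [v])" "distinct (v # qs @ [u])" using dist by auto
    moreover have "insert {u, v} (path_edges (u # ps @ [v])) \<subseteq> ?E" "insert {u, v} (path_edges (v # qs @ [u])) \<subseteq> ?E"
      using E by (simp_all add: subset_insertI2)
    ultimately show "facial_cycle ?E (u # ps @ [v])" "facial_cycle ?E (v # qs @ [u])"
      unfolding facial_cycle_def by simp_all
  qed
  moreover have "disc_face f1 (edges_image ?g (cycle_edges (u # ps @ [v])))"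
    "disc_face f2 (edges_image ?g (cycle_edges (v # qs @ [u])))"
  proof -
    have *: "edges_image ?g (path_edges (u # ps @ [v])) = edges_image g (path_edges (u # ps @ [v]))"
      "edges_image ?g (path_edges (v # qs @ [u])) = edges_image g (path_edges (v # qs @ [u]))"
      using E g by (auto intro!: edges_image_cong simp del: fun_upd_apply)
    have "edges_image ?g (cycle_edges (u # ps @ [v])) = edges_image g (path_edges (u # ps @ [v])) \<union> path_image \<gamma>"
      "edges_image ?g (cycle_edges (v # qs @ [u])) = edges_image g (path_edges (v # qs @ [u])) \<union> path_image \<gamma>"
      using cycle_edges_split[of u ps v "[]"] cycle_edges_split[of v qs u "[]"] *
      by (simp_all add: edges_image_Un edges_image_insert insert_commute) (simp_all add: edges_image_def Un_commute)
    then show "disc_face f1 (edges_image ?g (cycle_edges (u # ps @ [v])))"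
      "disc_face f2 (edges_image ?g (cycle_edges (v # qs @ [u])))" using df by simp_all
  qed
  ultimately have "plane_drawing V ?E ((u # ps @ [v]) # (v # qs @ [u]) # cs) p ?g O' (f1 # f2 # fs')"
    unfolding plane_drawing_def using d' sorted cover by (simp add: Un_assoc)
  then show ?thesis using sg' unfolding plane_map_def by blast
qed

lemma half_arc_images:
  fixes \<gamma> :: "real \<Rightarrow> complex"
  shows "subpath 0 (1/2) \<gamma> ` {0<..<1} = \<gamma> ` {0<..<1/2}" "subpath (1/2) 1 \<gamma> ` {0<..<1} = \<gamma> ` {1/2<..<1}"
proof -
  have "(\<lambda>t::real. (1/2 - 0) * t + 0) ` {0<..<1} = {0<..<1/2}"
  proof (intro equalityI subsetI)
    fix y :: real assume "y \<in> {0<..<1/2}"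
    then show "y \<in> (\<lambda>t. (1/2 - 0) * t + 0) ` {0<..<1}"
      by (intro image_eqI[of _ _ "2 * y"]) auto
  qed auto
  moreover have "subpath 0 (1/2) \<gamma> ` {0<..<1} = \<gamma> ` (\<lambda>t::real. (1/2 - 0) * t + 0) ` {0<..<1}"
    by (simp add: subpath_def image_image)
  ultimately show "subpath 0 (1/2) \<gamma> ` {0<..<1} = \<gamma> ` {0<..<1/2}" by simp
  have "(\<lambda>t::real. (1 - 1/2) * t + 1/2) ` {0<..<1} = {1/2<..<1}"
  proof (intro equalityI subsetI)
    fix y :: real assume "y \<in> {1/2<..<1}"
    then show "y \<in> (\<lambda>t. (1 - 1/2) * t + 1/2) ` {0<..<1}"
      by (intro image_eqI[of _ _ "2 * y - 1"]) (auto simp: field_simps)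
  qed auto
  moreover have "subpath (1/2) 1 \<gamma> ` {0<..<1} = \<gamma> ` (\<lambda>t::real. (1 - 1/2) * t + 1/2) ` {0<..<1}"
    by (simp add: subpath_def image_image)
  ultimately show "subpath (1/2) 1 \<gamma> ` {0<..<1} = \<gamma> ` {1/2<..<1}" by simp
qed

text \<open>The arc across the face is cut at its midpoint, where the new vertex is placed. Since \<open>u\<close> and \<open>v\<close> are
  consecutive on the face, one of the two new faces is a triangle.\<close>

lemma plane_map_add_vertex:
  assumes pm: "plane_map V E ((u # v # qs) # cs)" and x: "x \<notin> V"
  shows "plane_map (insert x V) (insert {x, u} (insert {x, v} E)) ([x, u, v] # (x # v # qs @ [u]) # cs)"
proof -
  have pm': "plane_map V E ((u # [] @ v # qs) # cs)" using pm by simp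
  obtain p g O' fs where sg: "simple_graph V E" and d: "plane_drawing V E ((u # [] @ v # qs) # cs) p g O' fs"
    using pm' unfolding plane_map_def by blast
  note d' = d[unfolded plane_drawing_def]
  have emb: "planar_embedding V E p g" and tri: "triangular_face E g O'" using d' by blast+
  have fc: "facial_cycle E (u # [] @ v # qs)" using plane_drawing_head[OF d] .
  obtain \<gamma> f1 f2 fs' where \<gamma>: "arc \<gamma>" "pathstart \<gamma> = p u" "pathfinish \<gamma> = p v"
    and disj: "\<gamma> ` {0<..<1} \<inter> (p ` V \<union> edges_image g E) = {}"
    and df: "disc_face f1 (edges_image g (path_edges (u # [] @ [v])) \<union> path_image \<gamma>)"
      "disc_face f2 (edges_image g (path_edges (v # qs @ [u])) \<union> path_image \<gamma>)"
    and sorted: "sorted_wrt disjnt (O' # f1 # f2 # fs')"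
    and cover: "O' \<union> \<Union>(set (f1 # f2 # fs')) = - (p ` V \<union> edges_image g E \<union> path_image \<gamma>)"
    and rest: "list_all2 (\<lambda>c f. facial_cycle E c \<and> disc_face f (edges_image g (cycle_edges c))) cs fs'"
    using plane_drawing_split[OF sg d] .
  have E: "{u, v} \<in> E" "path_edges (v # qs @ [u]) \<subseteq> E"
    and dist: "distinct (u # v # qs)" and len: "qs \<noteq> []"
    using fc cycle_edges_split[of u "[]" v qs] by (auto simp: facial_cycle_def)
  have uv: "u \<in> V" "v \<in> V" "u \<noteq> v" using E(1) sg dist by (auto simp: simple_graph_def)
  have xuv: "x \<noteq> u" "x \<noteq> v" using uv x by auto
  have EV: "e \<subseteq> V" if "e \<in> E" for e using sg that by (auto simp: simple_graph_def)
  define X where "X = p ` V \<union> edges_image g E"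
  define m where "m = \<gamma> (1/2)"
  define A B where "A = \<gamma> ` {0<..<1/2}" and "B = \<gamma> ` {1/2<..<1}"
  define \<gamma>1 \<gamma>2 where "\<gamma>1 = subpath 0 (1/2) \<gamma>" and "\<gamma>2 = subpath (1/2) 1 \<gamma>"
  define p' where "p' = p(x := m)"
  define g' where "g' = g({x, u} := \<gamma>1, {x, v} := \<gamma>2)"
  let ?V = "insert x V" and ?E = "insert {x, u} (insert {x, v} E)"
  have sg': "simple_graph ?V ?E" using sg uv xuv by (auto simp: simple_graph_def)
  have EE: "E \<subseteq> ?E" by blast
  have g'_old: "g' e = g e" if "e \<in> E" for e using EV[OF that] x by (auto simp: g'_def)
  have g'_new: "g' {x, u} = \<gamma>1" "g' {x, v} = \<gamma>2" using uv by (auto simp: g'_def doubleton_eq_iff)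
  have p'_old: "p' w = p w" if "w \<in> V" for w using that x by (auto simp: p'_def)
  have p'_x: "p' x = m" by (simp add: p'_def)
  have ends: "\<gamma> 0 = p u" "\<gamma> 1 = p v" using \<gamma> by (auto simp: pathstart_def pathfinish_def)
  have "{0<..<1::real} = {0<..<1/2} \<union> {1/2} \<union> {1/2<..<1}" by auto
  then have img_open: "\<gamma> ` {0<..<1} = A \<union> {m} \<union> B" unfolding A_def B_def m_def by (metis image_Un image_insert image_empty)
  have inj: "inj_on \<gamma> {0..1}" using \<gamma> by (simp add: arc_def)
  have AB: "A \<inter> B = {}" "m \<notin> A" "m \<notin> B"
  proof -
    have "A \<inter> B = \<gamma> ` ({0<..<1/2} \<inter> {1/2<..<1})"
      unfolding A_def B_def by (rule inj_on_image_Int[OF inj, symmetric]) auto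
    also have "{0<..<1/2} \<inter> {1/2<..<1::real} = {}" by auto
    finally show "A \<inter> B = {}" by simp
    have "m \<in> \<gamma> ` S \<longleftrightarrow> 1/2 \<in> S" if "S \<subseteq> {0..1}" for S
      unfolding m_def using that by (intro inj_on_image_mem_iff[OF inj]) auto
    then show "m \<notin> A" "m \<notin> B" unfolding A_def B_def by (simp_all add: subset_iff)
  qed
  have AX: "A \<inter> X = {}" "B \<inter> X = {}" "m \<notin> X" using disj unfolding img_open X_def by auto
  have pX: "p w \<in> X" if "w \<in> V" for w using that by (auto simp: X_def)
  have gX: "path_image (g e) \<subseteq> X" if "e \<in> E" for e using that by (auto simp: X_def edges_image_def)
  have goX: "g e ` {0<..<1} \<subseteq> X" if "e \<in> E" for e using gX[OF that] by (auto simp: path_image_def)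
  have arcs: "arc \<gamma>1" "arc \<gamma>2" using \<gamma>(1) by (auto simp: \<gamma>1_def \<gamma>2_def intro!: arc_subpath_arc)
  have ends12: "pathstart \<gamma>1 = p u" "pathfinish \<gamma>1 = m" "pathstart \<gamma>2 = m" "pathfinish \<gamma>2 = p v"
    by (simp_all add: \<gamma>1_def \<gamma>2_def m_def ends)
  have open12: "\<gamma>1 ` {0<..<1} = A" "\<gamma>2 ` {0<..<1} = B"
    by (simp_all add: \<gamma>1_def \<gamma>2_def A_def B_def half_arc_images)
  have img12: "path_image \<gamma>1 = A \<union> {p u, m}" "path_image \<gamma>2 = B \<union> {m, p v}"
    using path_image_open_arc[of \<gamma>1] path_image_open_arc[of \<gamma>2] ends12 open12 by auto
  have img: "path_image \<gamma> = path_image \<gamma>1 \<union> path_image \<gamma>2"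
    unfolding path_image_open_arc[of \<gamma>] \<gamma>(2,3) img_open img12 by auto
  have no_end: "p u \<notin> g e ` {0<..<1}" "p v \<notin> g e ` {0<..<1}" if "e \<in> E" for e
    using open_edge_no_vertex[OF sg emb that] uv by auto
  have "planar_embedding ?V ?E p' g'" unfolding planar_embedding_def
  proof (intro conjI ballI impI)
    have "inj_on p' V" using emb inj_on_cong[of V p' p] p'_old by (simp add: planar_embedding_def)
    moreover have "p' x \<notin> p' ` V" using AX(3) pX p'_old p'_x by force
    ultimately show "inj_on p' ?V" using x by simp
  next
    fix e assume e: "e \<in> ?E"
    have old: "p' ` e = p ` e" if "e \<in> E" for e using EV[OF that] p'_old by (intro image_cong) auto
    have all: "arc (g' e) \<and> {pathstart (g' e), pathfinish (g' e)} = p' ` e \<and> g' e ` {0<..<1} \<inter> p' ` ?V = {}"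
    proof -
      have pV: "p' ` ?V = insert m (p ` V)" using p'_old p'_x by (simp cong: image_cong)
      consider "e = {x, u}" | "e = {x, v}" | "e \<in> E" using e by blast
      then show ?thesis
      proof cases
        case 1
        have "A \<inter> insert m (p ` V) = {}" using AB(2) AX(1) by (auto simp: X_def)
        then show ?thesis unfolding 1 g'_new pV open12 ends12
          using arcs p'_old[OF uv(1)] p'_x by auto
      next
        case 2
        have "B \<inter> insert m (p ` V) = {}" using AB(3) AX(2) by (auto simp: X_def)
        then show ?thesis unfolding 2 g'_new pV open12 ends12
          using arcs p'_old[OF uv(2)] p'_x by auto
      next
        case 3
        have "g e ` {0<..<1} \<inter> p ` V = {}" "arc (g e)" "{pathstart (g e), pathfinish (g e)} = p ` e"
          using emb 3 by (auto simp: planar_embedding_def)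
        moreover have "m \<notin> g e ` {0<..<1}" using goX[OF 3] AX(3) by auto
        ultimately show ?thesis unfolding g'_old[OF 3] pV old[OF 3] by simp
      qed
    qed
    show "arc (g' e)" by (rule all[THEN conjunct1])
    show "{pathstart (g' e), pathfinish (g' e)} = p' ` e" by (rule all[THEN conjunct2, THEN conjunct1])
    show "g' e ` {0<..<1} \<inter> p' ` ?V = {}" by (rule all[THEN conjunct2, THEN conjunct2])
  next
    fix e e' assume e: "e \<in> ?E" and e': "e' \<in> ?E" and ne: "e \<noteq> e'"
    have sets: "S \<inter> (C \<union> {a, b}) = {}" if "S \<subseteq> X" "C \<inter> X = {}" "a \<notin> S" "b \<notin> S" for S C and a b :: complex
      using that by blast
    have old_new: "g e ` {0<..<1} \<inter> (A \<union> {p u, m}) = {}" "g e ` {0<..<1} \<inter> (B \<union> {m, p v}) = {}"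
      if "e \<in> E" for e
    proof -
      have "m \<notin> g e ` {0<..<1}" using goX[OF that] AX(3) by (meson subsetD)
      then show "g e ` {0<..<1} \<inter> (A \<union> {p u, m}) = {}" "g e ` {0<..<1} \<inter> (B \<union> {m, p v}) = {}"
        using sets[OF goX[OF that] AX(1) no_end(1)[OF that]] sets[OF goX[OF that] AX(2) _ no_end(2)[OF that]]
        by simp_all
    qed
    have new_old: "A \<inter> path_image (g e) = {}" "B \<inter> path_image (g e) = {}" if "e \<in> E" for e
      using disjoint_subset[OF AX(1) gX[OF that]] disjoint_subset[OF AX(2) gX[OF that]] .
    have new_new: "A \<inter> (B \<union> {m, p v}) = {}" "B \<inter> (A \<union> {p u, m}) = {}"
      using AB AX pX[OF uv(1)] pX[OF uv(2)] by blast+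
    have old_old: "g e ` {0<..<1} \<inter> path_image (g e') = {}" if "e \<in> E" "e' \<in> E" "e \<noteq> e'" for e e'
      using emb that by (simp add: planar_embedding_def)
    have "e = {x, u} \<or> e = {x, v} \<or> e \<in> E" "e' = {x, u} \<or> e' = {x, v} \<or> e' \<in> E"
      using e e' by simp_all
    then show "g' e ` {0<..<1} \<inter> path_image (g' e') = {}" using ne
      by (elim disjE) (simp_all only: g'_new g'_old open12 img12 old_old old_new new_old new_new simp_thms)
  qed
  moreover have old_img: "edges_image g' F = edges_image g F" if "F \<subseteq> E" for F
    using that g'_old by (intro edges_image_cong) auto
  moreover have "edges_image g' ?E = edges_image g E \<union> path_image \<gamma>"
    using old_img[of E] by (simp add: edges_image_insert g'_new img Un_ac)
  moreover have "p' ` ?V \<union> (edges_image g E \<union> path_image \<gamma>) = p ` V \<union> edges_image g E \<union> path_image \<gamma>"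
  proof -
    have "p' ` ?V = insert m (p ` V)" using p'_old p'_x by (simp cong: image_cong)
    moreover have "m \<in> path_image \<gamma>" unfolding img img12 by simp
    ultimately show ?thesis by auto
  qed
  moreover have "triangular_face ?E g' O'"
    by (rule triangular_face_mono[OF tri EE g'_old])
  moreover have "list_all2 (\<lambda>c f. facial_cycle ?E c \<and> disc_face f (edges_image g' (cycle_edges c))) cs fs'"
    by (rule list_all2_faces_mono[OF rest EE g'_old])
  moreover have c12: "cycle_edges [x, u, v] = {{x, u}, {x, v}} \<union> path_edges (u # [] @ [v])"
    "cycle_edges (x # v # qs @ [u]) = {{x, u}, {x, v}} \<union> path_edges (v # qs @ [u])"
    using cycle_edges_split[of x "[]" v "qs @ [u]"] path_edges_append[of "v # qs" u "[x]"]
    by (auto simp: cycle_edges_def insert_commute)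
  moreover have "facial_cycle ?E [x, u, v]" "facial_cycle ?E (x # v # qs @ [u])"
  proof -
    have "set (v # qs @ [u]) \<subseteq> V"
      using E(2) EV path_vertices[of v qs u] by (metis Union_least set_simps(2) set_append subsetD list.set(1) Un_insert_right sup_bot_right)
    then show "facial_cycle ?E (x # v # qs @ [u])"
      using x E dist len unfolding facial_cycle_def c12 by (cases qs) auto
    show "facial_cycle ?E [x, u, v]"
      using xuv uv E unfolding facial_cycle_def c12 by auto
  qed
  moreover have "disc_face f1 (edges_image g' (cycle_edges [x, u, v]))"
    "disc_face f2 (edges_image g' (cycle_edges (x # v # qs @ [u])))"
    using df old_img[of "path_edges (v # qs @ [u])"] old_img[of "path_edges (u # [] @ [v])"] E
    unfolding c12 edges_image_Un by (simp_all add: edges_image_insert g'_new img Un_ac) (simp_all add: edges_image_def Un_ac)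
  ultimately have "plane_drawing ?V ?E ([x, u, v] # (x # v # qs @ [u]) # cs) p' g' O' (f1 # f2 # fs')"
    unfolding plane_drawing_def using d' sorted cover by simp
  then show ?thesis using sg' unfolding plane_map_def by blast
qed

lemma plane_map_rotate:
  assumes "plane_map V E (c # cs)"
  shows "plane_map V E (rotate1 c # cs)"
  using assms unfolding plane_map_def plane_drawing_def list_all2_Cons1 facial_cycle_def
  by (simp add: cycle_edges_rotate1)

lemma plane_map_defer:
  assumes "plane_map V E (c # cs @ ds)"
  shows "plane_map V E (cs @ c # ds)"
proof -
  obtain p g O' fs where sg: "simple_graph V E" and d: "plane_drawing V E (c # cs @ ds) p g O' fs"
    using assms unfolding plane_map_def by blast
  obtain f fs' where f: "fs = f # fs'" "facial_cycle E c" "disc_face f (edges_image g (cycle_edges c))"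
    "list_all2 (\<lambda>c f. facial_cycle E c \<and> disc_face f (edges_image g (cycle_edges c))) (cs @ ds) fs'"
    using plane_drawing_head[OF d] by blast
  obtain xs ys where xy: "fs' = xs @ ys"
    "list_all2 (\<lambda>c f. facial_cycle E c \<and> disc_face f (edges_image g (cycle_edges c))) cs xs"
    "list_all2 (\<lambda>c f. facial_cycle E c \<and> disc_face f (edges_image g (cycle_edges c))) ds ys"
    using f(4) unfolding list_all2_append1 by blast
  have "sorted_wrt disjnt (O' # xs @ f # ys)"
    using d f(1) xy(1) by (auto simp: plane_drawing_def sorted_wrt_append disjnt_sym)
  moreover have "O' \<union> \<Union>(set (xs @ f # ys)) = O' \<union> \<Union>(set fs)" using f(1) xy(1) by auto
  moreover have "list_all2 (\<lambda>c f. facial_cycle E c \<and> disc_face f (edges_image g (cycle_edges c))) (cs @ c # ds) (xs @ f # ys)"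
    using f xy by (intro list_all2_appendI) auto
  ultimately have "plane_drawing V E (cs @ c # ds) p g O' (xs @ f # ys)"
    using d unfolding plane_drawing_def by metis
  then show ?thesis using sg unfolding plane_map_def by blast
qed

lemma planar_triangulation_plane_map:
  assumes "plane_map V E cs" "\<forall>c\<in>set cs. length c = 3"
  shows "planar_triangulation V E"
proof -
  obtain p g O' fs where sg: "simple_graph V E" and d: "plane_drawing V E cs p g O' fs"
    using assms unfolding plane_map_def by blast
  note d' = d[unfolded plane_drawing_def]
  have ne: "\<forall>f\<in>set fs. \<exists>c\<in>set cs. facial_cycle E c \<and> disc_face f (edges_image g (cycle_edges c))"
  proof
    fix f assume "f \<in> set fs"
    then obtain i where i: "i < length fs" "f = fs ! i" by (metis in_set_conv_nth)
    have l: "list_all2 (\<lambda>c f. facial_cycle E c \<and> disc_face f (edges_image g (cycle_edges c))) cs fs"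
      using d' by blast
    show "\<exists>c\<in>set cs. facial_cycle E c \<and> disc_face f (edges_image g (cycle_edges c))"
      using list_all2_nthD2[OF l i(1)] i(2) i(1) list_all2_lengthD[OF l]
      by (intro bexI[of _ "cs ! i"]) simp_all
  qed
  have "components (- (p ` V \<union> edges_image g E)) = set (O' # fs)"
  proof (rule components_open_unique)
    have "pairwise disjnt (set xs)" if "sorted_wrt disjnt xs" for xs :: "complex set list"
      using that by (induction xs) (simp_all add: pairwise_insert disjnt_sym)
    then show "pairwise disjnt (set (O' # fs))" using d' by blast
    show "\<Union> (set (O' # fs)) = - (p ` V \<union> edges_image g E)" using d' by simp
    show "open X \<and> connected X \<and> X \<noteq> {}" if "X \<in> set (O' # fs)" for X
    proof (cases "X = O'")
      case True
      then show ?thesis using d' by blast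
    next
      case False
      then have "X \<in> set fs" using that by simp
      then obtain B where "disc_face X B" using ne by blast
      then show ?thesis using disc_face_open_connected(1-3)[of X B] by blast
    qed
  qed
  then have faces: "embedding_faces V E p g = insert O' (set fs)"
    by (simp add: embedding_faces_def edges_image_def)
  have "triangular_face E g f" if "f \<in> set fs" for f
  proof -
    from bspec[OF ne that] obtain c
      where c: "c \<in> set cs" "facial_cycle E c" "disc_face f (edges_image g (cycle_edges c))"
      by blast
    have "length c = 3" using c(1) assms(2) by blast
    then obtain u v w where uvw: "c = [u, v, w]"
      by (auto simp: numeral_3_eq_3 length_Suc_conv)
    have e: "cycle_edges c = {{u, v}, {v, w}, {w, u}}" by (simp add: uvw cycle_edges_def)
    have "graph_cycle E [u, v, w]"
      using c(2) e unfolding facial_cycle_def graph_cycle_triangle uvw by simp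
    moreover have "frontier f = path_image (g {u, v}) \<union> path_image (g {v, w}) \<union> path_image (g {w, u})"
      using disc_face_open_connected(4)[OF c(3)] unfolding e by (simp add: edges_image_def Un_assoc)
    ultimately show ?thesis unfolding triangular_face_def by blast
  qed
  moreover have "triangular_face E g O'" using d' by blast
  ultimately have "\<forall>f\<in>embedding_faces V E p g. triangular_face E g f" unfolding faces by simp
  moreover have "planar_embedding V E p g" using d' by blast
  ultimately show ?thesis using sg unfolding planar_triangulation_def by blast
qed

section \<open>Executable descriptions of drawings\<close>

text \<open>A drawing is described by a list of steps that act on the first face of a list of faces. The
  description is executable; its state records the new vertices, the new edges and the faces.\<close>

datatype draw_step = Rotate nat | Next | Chord nat | Vertex nat

type_synonym draw_state = "nat list \<times> (nat \<times> nat) list \<times> nat list list"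

fun draw :: "draw_step \<Rightarrow> draw_state \<Rightarrow> draw_state option" where
  "draw (Rotate n) (vs, es, c # fs) = Some (vs, es, rotate n c # fs)"
| "draw Next (vs, es, c # fs) = Some (vs, es, fs @ [c])"
| "draw (Chord n) (vs, es, (u # c) # fs) =
    (case drop n c of
      v # qs \<Rightarrow> if take n c \<noteq> [] \<and> qs \<noteq> [] \<and> (u \<in> set vs \<or> v \<in> set vs) \<and> (u, v) \<notin> set es \<and> (v, u) \<notin> set es
        then Some (vs, (u, v) # es, (u # take n c @ [v]) # (v # qs @ [u]) # fs) else None
    | [] \<Rightarrow> None)"
| "draw (Vertex x) (vs, es, (u # v # c) # fs) =
    (if x \<in> set vs then None
     else Some (x # vs, (x, u) # (x, v) # es, [x, u, v] # (x # v # c @ [u]) # fs))"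
| "draw _ _ = None"

fun draw_all :: "draw_step list \<Rightarrow> draw_state \<Rightarrow> draw_state option" where
  "draw_all [] s = Some s"
| "draw_all (a # as) s = (case draw a s of None \<Rightarrow> None | Some t \<Rightarrow> draw_all as t)"

definition map_edges :: "('a \<Rightarrow> 'b) \<Rightarrow> ('a \<times> 'a) set \<Rightarrow> 'b set set" where
  "map_edges \<phi> S = (\<lambda>(a, b). {\<phi> a, \<phi> b}) ` S"

lemma map_edges_insert: "map_edges \<phi> (insert (a, b) S) = insert {\<phi> a, \<phi> b} (map_edges \<phi> S)"
  by (simp add: map_edges_def)

lemma plane_map_rotate_n:
  "plane_map V E (c # cs) \<Longrightarrow> plane_map V E (rotate n c # cs)"
  by (induction n) (simp_all add: plane_map_rotate rotate_Suc)

definition drawn_state where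
  "drawn_state V E \<phi> cs s \<longleftrightarrow> (case s of (vs, es, fs) \<Rightarrow>
     plane_map (V \<union> \<phi> ` set vs) (E \<union> map_edges \<phi> (set es)) (map (map \<phi>) fs @ cs))"

lemma draw_sound:
  fixes \<phi> :: "nat \<Rightarrow> 'a"
  assumes inj: "inj \<phi>" and sg: "simple_graph V E" 
    and d: "drawn_state V E \<phi> cs s" and step: "draw a s = Some t"
    and new: "\<And>x. a = Vertex x \<Longrightarrow> \<phi> x \<notin> V" and old: "\<And>x. x \<in> set (fst s) \<Longrightarrow> \<phi> x \<notin> V"
  shows "drawn_state V E \<phi> cs t" "\<And>x. x \<in> set (fst t) \<Longrightarrow> \<phi> x \<notin> V"
proof -
  have "drawn_state V E \<phi> cs t \<and> (\<forall>x \<in> set (fst t). \<phi> x \<notin> V)"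
    using step d new old
  proof (induction a s rule: draw.induct)
    case (1 n vs es c fs)
    then show ?case by (auto simp: drawn_state_def rotate_map[symmetric] plane_map_rotate_n)
  next
    case (2 vs es c fs)
    then show ?case
      using plane_map_defer[of _ _ "map \<phi> c" "map (map \<phi>) fs" cs] by (auto simp: drawn_state_def)
  next
    case (3 n vs es u c fs)
    obtain v qs where dr: "drop n c = v # qs" using 3(1) by (auto split: list.splits)
    have c: "c = take n c @ v # qs" using dr by (metis append_take_drop_id)
    have cond: "take n c \<noteq> []" "qs \<noteq> []" "u \<in> set vs \<or> v \<in> set vs" "(u, v) \<notin> set es" "(v, u) \<notin> set es"
      and t: "t = (vs, (u, v) # es, (u # take n c @ [v]) # (v # qs @ [u]) # fs)"
      using 3(1) dr by (auto split: if_splits)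
    let ?E = "E \<union> map_edges \<phi> (set es)"
    have "{\<phi> u, \<phi> v} \<notin> E"
      using cond(3) 3(4) sg unfolding simple_graph_def by fastforce
    moreover have "{\<phi> u, \<phi> v} \<notin> map_edges \<phi> (set es)"
      using cond(4,5) inj by (auto simp: map_edges_def doubleton_eq_iff inj_eq)
    ultimately have "{\<phi> u, \<phi> v} \<notin> ?E" by simp
    moreover have "map \<phi> (u # c) = \<phi> u # map \<phi> (take n c) @ \<phi> v # map \<phi> qs"
      by (subst c) simp
    then have "plane_map (V \<union> \<phi> ` set vs) ?E
        ((\<phi> u # map \<phi> (take n c) @ \<phi> v # map \<phi> qs) # map (map \<phi>) fs @ cs)"
      using 3(2) by (simp add: drawn_state_def)
    ultimately have "plane_map (V \<union> \<phi> ` set vs) (insert {\<phi> u, \<phi> v} ?E)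
       ((\<phi> u # map \<phi> (take n c) @ [\<phi> v]) # (\<phi> v # map \<phi> qs @ [\<phi> u]) # map (map \<phi>) fs @ cs)"
      using cond(1,2) by (intro plane_map_add_chord) auto
    then show ?case using 3(4) unfolding t by (simp add: drawn_state_def map_edges_insert)
  next
    case (4 x vs es u v c fs)
    have x: "x \<notin> set vs" and t: "t = (x # vs, (x, u) # (x, v) # es, [x, u, v] # (x # v # c @ [u]) # fs)"
      using 4(1) by (auto split: if_splits)
    let ?E = "E \<union> map_edges \<phi> (set es)"
    have "\<phi> x \<notin> V \<union> \<phi> ` set vs" using 4(3)[of x] x inj by (auto simp: inj_eq)
    moreover have "plane_map (V \<union> \<phi> ` set vs) ?E ((\<phi> u # \<phi> v # map \<phi> c) # map (map \<phi>) fs @ cs)"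
      using 4(2) by (simp add: drawn_state_def)
    ultimately have "plane_map (insert (\<phi> x) (V \<union> \<phi> ` set vs)) (insert {\<phi> x, \<phi> u} (insert {\<phi> x, \<phi> v} ?E))
       ([\<phi> x, \<phi> u, \<phi> v] # (\<phi> x # \<phi> v # map \<phi> c @ [\<phi> u]) # map (map \<phi>) fs @ cs)"
      by (intro plane_map_add_vertex)
    then show ?case using 4(3,4) unfolding t by (auto simp add: drawn_state_def map_edges_insert)
  qed auto
  then show "drawn_state V E \<phi> cs t" "\<And>x. x \<in> set (fst t) \<Longrightarrow> \<phi> x \<notin> V" by auto
qed

lemma draw_all_sound_aux:
  fixes \<phi> :: "nat \<Rightarrow> 'a"
  assumes inj: "inj \<phi>" and sg: "simple_graph V E" 
    and "drawn_state V E \<phi> cs s" "draw_all as s = Some t"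
    and "\<And>x. Vertex x \<in> set as \<Longrightarrow> \<phi> x \<notin> V" "\<And>x. x \<in> set (fst s) \<Longrightarrow> \<phi> x \<notin> V"
  shows "drawn_state V E \<phi> cs t"
  using assms(3-)
proof (induction as arbitrary: s)
  case (Cons a as)
  obtain r where r: "draw a s = Some r" "draw_all as r = Some t"
    using Cons.prems(2) by (auto split: option.splits)
  have *: "\<phi> x \<notin> V" if "a = Vertex x" for x using Cons.prems(3)[of x] that by simp
  note step = draw_sound[OF inj sg Cons.prems(1) r(1) * Cons.prems(4)]
  show ?case
  proof (rule Cons.IH[OF _ r(2)])
    show "drawn_state V E \<phi> cs r" by (rule step(1))
    show "\<phi> x \<notin> V" if "Vertex x \<in> set as" for x using Cons.prems(3)[of x] that by simp
    show "\<phi> x \<notin> V" if "x \<in> set (fst r)" for x by (rule step(2)[OF _ _ that])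
  qed
qed simp

text \<open>Labels are transported by an injection \<open>\<phi>\<close>, so that the same description can be used to draw
  many disjoint copies. A chord has at least one new end, which keeps it distinct from all old
  edges; this is why the interpreter checks for it.\<close>

theorem draw_all_sound:
  fixes \<phi> :: "nat \<Rightarrow> 'a"
  assumes "inj \<phi>" and pm: "plane_map V E (map \<phi> c # cs)" 
    and "draw_all as ([], [], [c]) = Some (vs, es, fs)"
    and "\<And>x. Vertex x \<in> set as \<Longrightarrow> \<phi> x \<notin> V"
  shows "plane_map (V \<union> \<phi> ` set vs) (E \<union> map_edges \<phi> (set es)) (map (map \<phi>) fs @ cs)"
proof -
  have "drawn_state V E \<phi> cs ([], [], [c])" using pm by (simp add: drawn_state_def map_edges_def)
  moreover have "simple_graph V E" using pm by (simp add: plane_map_def)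
  ultimately have "drawn_state V E \<phi> cs (vs, es, fs)"
    using draw_all_sound_aux[of \<phi> V E cs "([], [], [c])" as "(vs, es, fs)"] assms by simp
  then show ?thesis by (simp add: drawn_state_def)
qed

section \<open>The initial triangle\<close>

text \<open>The start of every drawing: a triangle with straight edges. Its bounded face is a convex set.\<close>

lemma plane_map_triangle:
  "plane_map {0, 1, 2 :: nat} {{0, 1}, {1, 2}, {2, 0}} [[0, 1, 2]]"
proof -
  note One_nat_def [simp del]
  define p :: "nat \<Rightarrow> complex" where "p v = (if v = 0 then 0 else if v = 1 then 1 else \<i>)" for v
  define g where "g e = (if e = {0, 1} then linepath 0 1 else if e = {1, 2} then linepath 1 \<i> else linepath \<i> 0)"
    for e :: "nat set"
  let ?V = "{0, 1, 2 :: nat}" and ?E = "{{0, 1}, {1, 2}, {2, 0 :: nat}}"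
  let ?T = "convex hull {0, 1, \<i>}"
  have ne: "{0, 1} \<noteq> {1, 2 :: nat}" "{0, 1} \<noteq> {2, 0 :: nat}" "{1, 2} \<noteq> {2, 0 :: nat}"
    by (auto simp: doubleton_eq_iff)
  have g: "g {0, 1} = linepath 0 1" "g {1, 2} = linepath 1 \<i>" "g {2, 0} = linepath \<i> 0"
    using ne by (auto simp: g_def)
  have p: "p 0 = 0" "p 1 = 1" "p 2 = \<i>" by (auto simp: p_def)
  have i1: "\<i> \<noteq> 1" "1 \<noteq> \<i>" by (auto simp: complex_eq_iff)
  have sg: "simple_graph ?V ?E" by (auto simp: simple_graph_def)
  have open_images: "linepath 0 1 ` {0<..<1} = {z. 0 < Re z \<and> Re z < 1 \<and> Im z = 0}"
    "linepath 1 \<i> ` {0<..<1} = {z. 0 < Im z \<and> Im z < 1 \<and> Re z = 1 - Im z}"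
    "linepath \<i> 0 ` {0<..<1} = {z. 0 < Im z \<and> Im z < 1 \<and> Re z = 0}"
  proof -
    show "linepath 0 1 ` {0<..<1} = {z. 0 < Re z \<and> Re z < 1 \<and> Im z = 0}"
      by (auto simp: linepath_def complex_eq_iff intro!: image_eqI[where x = "Re _"])
    show "linepath 1 \<i> ` {0<..<1} = {z. 0 < Im z \<and> Im z < 1 \<and> Re z = 1 - Im z}"
      by (auto simp: linepath_def complex_eq_iff intro!: image_eqI[where x = "Im _"])
    show "linepath \<i> 0 ` {0<..<1} = {z. 0 < Im z \<and> Im z < 1 \<and> Re z = 0}"
      by (auto simp: linepath_def complex_eq_iff intro!: image_eqI[where x = "1 - Im _"])
  qed
  have imgs: "path_image (linepath 0 1) = {z. 0 < Re z \<and> Re z < 1 \<and> Im z = 0} \<union> {0, 1}"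
    "path_image (linepath 1 \<i>) = {z. 0 < Im z \<and> Im z < 1 \<and> Re z = 1 - Im z} \<union> {1, \<i>}"
    "path_image (linepath \<i> 0) = {z. 0 < Im z \<and> Im z < 1 \<and> Re z = 0} \<union> {\<i>, 0}"
    using path_image_open_arc[of "linepath (0::complex) 1"] path_image_open_arc[of "linepath 1 \<i>"]
      path_image_open_arc[of "linepath \<i> 0"] by (simp_all only: open_images pathstart_linepath pathfinish_linepath)
  let ?A = "{z. 0 < Re z \<and> Re z < 1 \<and> Im z = 0}" and ?B = "{z. 0 < Im z \<and> Im z < 1 \<and> Re z = 1 - Im z}"
    and ?C = "{z. 0 < Im z \<and> Im z < 1 \<and> Re z = 0}"
  have d: "?A \<inter> {0, 1, \<i>} = {}" "?B \<inter> {0, 1, \<i>} = {}" "?C \<inter> {0, 1, \<i>} = {}"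
    "?A \<inter> (?B \<union> {1, \<i>}) = {}" "?A \<inter> (?C \<union> {\<i>, 0}) = {}" "?B \<inter> (?A \<union> {0, 1}) = {}"
    "?B \<inter> (?C \<union> {\<i>, 0}) = {}" "?C \<inter> (?A \<union> {0, 1}) = {}" "?C \<inter> (?B \<union> {1, \<i>}) = {}"
    by (auto simp: complex_eq_iff)
  have emb: "planar_embedding ?V ?E p g"
    unfolding planar_embedding_def
  proof (intro conjI)
    show "inj_on p ?V" using i1 by (auto simp: inj_on_def p_def)
    show "\<forall>e\<in>?E. arc (g e) \<and> {pathstart (g e), pathfinish (g e)} = p ` e"
      using i1 by (simp add: g p arc_linepath)
    show "\<forall>e\<in>?E. g e ` {0<..<1} \<inter> p ` ?V = {}"
      by (intro ballI, elim insertE emptyE) (simp_all only: g p image_insert image_empty open_images d)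
    show "\<forall>e\<in>?E. \<forall>e'\<in>?E. e \<noteq> e' \<longrightarrow> g e ` {0<..<1} \<inter> path_image (g e') = {}"
      by (intro ballI impI, elim insertE emptyE) (simp_all only: g open_images imgs d simp_thms)
  qed
  have aff: "\<not> collinear {0, 1, \<i>}"
    by (simp add: collinear_lemma complex_eq_iff)
  have T: "compact ?T" "convex ?T" by (auto intro!: finite_imp_compact_convex_hull)
  have "interior ?T \<noteq> {}"
    using aff i1 by (subst interior_convex_hull_eq_empty) (auto simp: collinear_3_eq_affine_dependent)
  have frT: "frontier ?T = edges_image g ?E"
    by (simp add: frontier_of_triangle edges_image_def g Un_assoc)
  have clT: "closed ?T" using T(1) by (rule compact_imp_closed)
  have "homeomorphism ?T (id ` ?T) id id" by (simp add: homeomorphism_def)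
  from disc_face_convex_image[OF this T \<open>interior ?T \<noteq> {}\<close>]
  have df: "disc_face (interior ?T) (edges_image g ?E)"
    using frT clT by (simp add: frontier_def closure_closed)
  have ce: "cycle_edges [0, 1, 2 :: nat] = ?E" by (simp add: cycle_edges_def)
  have drawing: "p ` ?V \<union> edges_image g ?E = frontier ?T"
  proof -
    have "p ` ?V \<subseteq> edges_image g ?E" by (auto simp: edges_image_def g p)
    then show ?thesis using frT by auto
  qed
  have "plane_drawing ?V ?E [[0, 1, 2]] p g (- ?T) [interior ?T]"
    unfolding plane_drawing_def
  proof (intro conjI)
    show "open (- ?T)" using clT by (rule open_Compl)
    show "connected (- ?T)"
      using T by (intro connected_complement_bounded_convex compact_imp_bounded) auto
    show "- ?T \<noteq> {}"
      using T(1) compact_imp_bounded[of ?T] not_bounded_UNIV by (metis Compl_empty_eq double_complement)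
    show "triangular_face ?E g (- ?T)"
      unfolding triangular_face_def graph_cycle_triangle frontier_complement
      using frT by (intro exI[of _ 0] exI[of _ 1] exI[of _ 2]) (simp add: edges_image_def Un_assoc)
    show "sorted_wrt disjnt (- ?T # [interior ?T])"
      using interior_subset[of ?T] by (auto simp: disjnt_def)
    show "- ?T \<union> \<Union>(set [interior ?T]) = - (p ` ?V \<union> edges_image g ?E)"
      unfolding drawing frontier_def using clT interior_subset[of ?T] by (auto simp: closure_closed)
    show "list_all2 (\<lambda>c f. facial_cycle ?E c \<and> disc_face f (edges_image g (cycle_edges c))) [[0, 1, 2]] [interior ?T]"
      using df by (simp add: facial_cycle_def ce)
  qed (rule emb)
  then show ?thesis using sg unfolding plane_map_def by blast
qed

section \<open>Hitting sets and the gadget\<close>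

text \<open>A branching certificate that every set meeting all the listed sets has more than \<open>k\<close> elements:
  some element \<open>v\<close> of the first set is in the hitting set; the elements of that set tried before \<open>v\<close>
  may be assumed not to be in it and are deleted from the other sets.\<close>

fun hits_exceed :: "nat \<Rightarrow> 'a list list \<Rightarrow> bool" and branch :: "nat \<Rightarrow> 'a list \<Rightarrow> 'a list list \<Rightarrow> bool" where
  "hits_exceed k [] = False"
| "hits_exceed 0 (c # cs) = True"
| "hits_exceed (Suc k) (c # cs) = branch k c cs"
| "branch k [] cs = True"
| "branch k (v # c) cs = (hits_exceed k (filter (\<lambda>d. v \<notin> set d) cs) \<and> branch k c (map (removeAll v) cs))"

lemma hits_exceed_sound:
  "hits_exceed k cs \<Longrightarrow> finite D \<Longrightarrow> (\<forall>c\<in>set cs. D \<inter> set c \<noteq> {}) \<Longrightarrow> k < card D"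
  "branch k c cs \<Longrightarrow> finite D \<Longrightarrow> D \<inter> set c \<noteq> {} \<Longrightarrow> (\<forall>c\<in>set cs. D \<inter> set c \<noteq> {}) \<Longrightarrow> Suc k < card D"
proof (induction k cs and k c cs arbitrary: D and D rule: hits_exceed_branch.induct)
  case (2 c cs)
  then show ?case by (auto simp: card_gt_0_iff)
next
  case (5 k v c cs)
  show ?case
  proof (cases "v \<in> D")
    case True
    have "k < card (D - {v})" using 5 by (intro "5.IH"(1)) auto
    then show ?thesis using True 5(4) by (simp add: card_Diff_singleton)
  next
    case False
    have *: "D \<inter> set (removeAll v d) = D \<inter> set d" for d using False by auto
    show ?thesis using 5 False unfolding * by (intro "5.IH"(2)) (auto simp: *)
  qed
qed auto

text \<open>The gadget. Its core are the 16 vertices 3 to 18, which span a plane graph with outer cycle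
  17, 8, 4, 13 and all other faces triangles. The vertices 0, 1, 2 are those
  of the surrounding triangle. The apex 0 is joined to the whole outer cycle, and 17 is also joined
  to 1 and 2. An induced forest contains at most 8 of the
  core vertices; if it contains 8 of them, it contains 17 or connects two of 8, 4 and 13, and then
  the apex cannot be added together with 1 or 2.\<close>

definition gadget_edges :: "(nat \<times> nat) list" where
  "gadget_edges =
    [(0,1), (0,2), (1,17), (2,17), (0,17), (0,8), (0,4), (0,13), (3,6), (3,7), (3,10), (3,13),
    (3,15), (3,16), (4,7), (4,8), (4,12), (4,13), (4,18), (5,6), (5,9), (5,11), (5,14), (5,15),
    (6,9), (6,10), (6,15), (7,11), (7,12), (7,13), (7,15), (8,10), (8,16), (8,17), (8,18),
    (9,10), (9,14), (9,18), (10,16), (10,18), (11,12), (11,14), (11,15), (12,14), (12,18),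
    (13,16), (13,17), (14,18), (16,17)]"
text \<open>These cycles of the core cannot be destroyed by the removal of 7 vertices.\<close>

definition core_cycles :: "nat list list" where
  "core_cycles =
    [[3,6,10], [3,6,15], [3,7,13], [3,7,15], [3,10,16], [3,13,16], [4,7,12], [4,12,18], [5,6,9],
    [5,6,15], [5,9,14], [5,11,14], [5,11,15], [6,9,10], [7,11,12], [7,11,15], [8,10,16],
    [8,10,18], [8,16,17], [9,10,18], [9,14,18], [11,12,14], [12,14,18], [13,16,17], [4,8,16,13],
    [4,8,17,13], [3,6,5,11,7], [3,7,4,8,10], [3,10,8,17,13], [3,10,9,5,15], [3,10,18,4,13],
    [4,7,11,14,18], [5,6,10,18,14], [5,9,18,12,11], [5,14,12,7,15], [3,6,9,14,11,7],
    [3,6,9,18,4,7], [3,10,9,14,11,15], [3,13,4,12,11,15], [4,7,11,5,9,18], [4,7,15,5,14,18],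
    [4,7,15,6,10,18], [4,8,10,9,14,12], [6,9,14,12,7,15], [6,9,18,12,11,15], [6,10,18,14,11,15],
    [7,12,18,8,16,13], [7,12,18,8,17,13], [3,6,5,14,18,4,7], [3,6,9,18,8,17,13],
    [3,10,8,4,12,11,15], [3,10,9,14,12,4,13], [3,13,4,12,14,5,15], [4,7,11,5,6,10,18],
    [4,8,10,9,5,11,12], [6,10,8,17,13,7,15], [3,10,8,4,12,14,5,15], [3,10,9,5,11,12,4,13],
    [3,13,17,8,18,9,5,15], [3,13,17,8,18,12,11,15], [5,9,10,8,17,13,7,15],
    [7,12,14,9,10,8,17,13], [3,6,5,11,12,18,8,17,13], [5,6,10,8,17,13,7,12,14]]"
text \<open>These cycles avoid the vertex 17; some of them pass through the apex 0. They cannot be destroyed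
  by the removal of 7 vertices different from the apex.\<close>

definition apex_cycles :: "nat list list" where
  "apex_cycles =
    [[4,8,0], [4,13,0], [3,6,15], [3,7,13], [3,7,15], [3,10,16], [3,13,16], [4,7,12], [4,12,18],
    [5,6,9], [5,6,15], [5,9,14], [5,11,14], [5,11,15], [6,9,10], [7,11,12], [7,11,15],
    [8,10,16], [8,10,18], [9,10,18], [9,14,18], [11,12,14], [12,14,18], [8,16,13,0],
    [3,10,8,0,13], [3,6,5,11,7], [4,7,11,14,18], [5,6,10,18,14], [5,9,18,12,11], [5,14,12,7,15],
    [3,6,5,14,12,7], [3,6,9,14,11,7], [3,6,9,14,12,7], [3,6,9,18,4,7], [3,6,9,18,8,16],
    [3,7,12,18,8,16], [4,7,11,5,9,18], [4,7,15,5,14,18], [4,7,15,6,10,18], [5,6,10,18,12,11],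
    [5,9,18,12,7,15], [6,9,14,12,7,15], [6,9,18,12,7,15], [6,9,18,12,11,15], [6,10,16,13,7,15],
    [6,10,18,12,11,15], [6,10,18,14,11,15], [7,12,18,10,16,13], [3,6,9,18,8,0,13],
    [6,10,8,0,13,7,15], [3,6,5,14,18,4,7], [3,6,5,14,18,8,16], [3,7,11,14,18,8,16],
    [3,15,5,9,18,8,16], [3,15,11,12,18,8,16], [4,7,11,5,6,10,18], [5,6,10,16,13,7,11],
    [5,9,10,16,13,7,15], [7,11,14,18,10,16,13], [7,12,14,9,10,16,13], [3,13,0,8,18,9,5,15],
    [3,13,0,8,18,12,11,15], [5,9,10,8,0,13,7,15], [7,12,14,9,10,8,0,13], [3,6,5,11,12,18,8,16],
    [3,7,11,5,9,18,8,16], [5,6,10,16,13,7,12,14], [5,14,18,10,16,13,7,15],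
    [3,6,5,11,12,18,8,0,13], [5,6,10,8,0,13,7,12,14]]"
definition cyclic_list :: "(nat \<times> nat) list \<Rightarrow> nat list \<Rightarrow> bool" where
  "cyclic_list es c \<longleftrightarrow> 3 \<le> length c \<and> distinct c \<and>
     list_all (\<lambda>(x, y). (x, y) \<in> set es \<or> (y, x) \<in> set es) (zip c (rotate1 c))"
lemma core_cycles_valid: "list_all (\<lambda>c. cyclic_list gadget_edges c \<and> list_all (\<lambda>i. 3 \<le> i \<and> i < 19) c) core_cycles" by code_simp
lemma apex_cycles_valid: "list_all (\<lambda>c. cyclic_list gadget_edges c \<and> list_all (\<lambda>i. i = 0 \<or> 3 \<le> i \<and> i < 19 \<and> i \<noteq> 17) c) apex_cycles" by code_simp
lemma core_cycles_hits: "hits_exceed 7 core_cycles" by code_simp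
lemma apex_cycles_hits: "hits_exceed 7 (map (removeAll 0) apex_cycles)" by code_simp

section \<open>Induced forests in a gadget and in a block\<close>

lemma cyclic_list_graph_cycle:
  assumes c: "cyclic_list es c" and inj: "inj_on \<psi> (set c)"
    and E: "\<And>x y. (x, y) \<in> set es \<Longrightarrow> {\<psi> x, \<psi> y} \<in> E"
  shows "graph_cycle E (map \<psi> c)"
  unfolding graph_cycle_def
proof (intro conjI allI impI)
  show "3 \<le> length (map \<psi> c)" "distinct (map \<psi> c)"
    using c inj by (auto simp: cyclic_list_def distinct_map)
  fix i assume "i < length (map \<psi> c)"
  then have i: "i < length c" by simp
  then have "0 < length c" by linarith
  then have i': "Suc i mod length c < length c" by (rule mod_less_divisor)
  have "(c ! i, c ! (Suc i mod length c)) \<in> set (zip c (rotate1 c))"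
    using i nth_rotate1[OF i] by (auto simp: set_zip)
  then have "(c ! i, c ! (Suc i mod length c)) \<in> set es \<or> (c ! (Suc i mod length c), c ! i) \<in> set es"
    using c by (auto simp: cyclic_list_def list_all_iff)
  then have "{\<psi> (c ! i), \<psi> (c ! (Suc i mod length c))} \<in> E"
    using E by (metis insert_commute)
  then show "{map \<psi> c ! i, map \<psi> c ! (Suc i mod length (map \<psi> c))} \<in> E" using i i' by simp
qed

lemma forest_misses_cycle:
  assumes "forest (induced_edges E F)" "cyclic_list es c" "inj_on \<psi> (set c)"
    and "\<And>x y. (x, y) \<in> set es \<Longrightarrow> {\<psi> x, \<psi> y} \<in> E"
  shows "\<exists>i\<in>set c. \<psi> i \<notin> F"
proof (rule ccontr)
  assume "\<not> ?thesis"
  then have F: "\<psi> ` set c \<subseteq> F" by auto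
  have "graph_cycle E (map \<psi> c)" using cyclic_list_graph_cycle[OF assms(2-4)] .
  moreover have "{map \<psi> c ! i, map \<psi> c ! (Suc i mod length c)} \<subseteq> F" if "i < length c" for i
  proof -
    have "0 < length c" using that by linarith
    then have "Suc i mod length c < length c" by (rule mod_less_divisor)
    then show ?thesis using F that by auto
  qed
  ultimately have "graph_cycle (induced_edges E F) (map \<psi> c)"
    by (simp add: graph_cycle_def induced_edges_def)
  then show False using assms(1) by (auto simp: forest_def)
qed

text \<open>The vertices outside a forest meet every cycle. If the apex 0 and another vertex of the triangle are
  in the forest, then 17 is not, because it forms a triangle with them; the other missing core
  vertices still meet all cycles that avoid 17 and contain no vertex outside the core but the apex.\<close>

lemma gadget_bound:
  fixes \<psi> :: "nat \<Rightarrow> 'a"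
  assumes inj: "inj_on \<psi> {..<19}" and f: "forest (induced_edges E F)"
    and E: "\<And>x y. (x, y) \<in> set gadget_edges \<Longrightarrow> {\<psi> x, \<psi> y} \<in> E"
  shows "card {i \<in> {3..<19}. \<psi> i \<in> F} \<le> 8"
    "\<psi> 0 \<in> F \<Longrightarrow> \<psi> 1 \<in> F \<or> \<psi> 2 \<in> F \<Longrightarrow> card {i \<in> {3..<19}. \<psi> i \<in> F} \<le> 7"
proof -
  let ?D = "{i \<in> {3..<19}. \<psi> i \<notin> F}"
  have "16 = card {3..<19::nat}" by simp
  also have "\<dots> = card ({i \<in> {3..<19}. \<psi> i \<in> F} \<union> ?D)" by (rule arg_cong[of _ _ card]) auto
  also have "\<dots> = card {i \<in> {3..<19}. \<psi> i \<in> F} + card ?D" by (rule card_Un_disjoint) auto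
  finally have card: "16 = card {i \<in> {3..<19}. \<psi> i \<in> F} + card ?D" .
  have hit: "\<exists>i\<in>set c. \<psi> i \<notin> F" if "cyclic_list gadget_edges c" "set c \<subseteq> {..<19}" for c
    by (rule forest_misses_cycle[OF f that(1) inj_on_subset[OF inj that(2)] E])
  have "?D \<inter> set c \<noteq> {}" if "c \<in> set core_cycles" for c
  proof -
    have c: "cyclic_list gadget_edges c" "\<forall>i\<in>set c. 3 \<le> i \<and> i < 19"
      using core_cycles_valid that by (auto simp: list_all_iff)
    then have "set c \<subseteq> {..<19}" by auto
    from hit[OF c(1) this] show ?thesis using c(2) by auto
  qed
  then have "7 < card ?D" by (intro hits_exceed_sound(1)[OF core_cycles_hits]) auto
  then show "card {i \<in> {3..<19}. \<psi> i \<in> F} \<le> 8" using card by simp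
  assume 0: "\<psi> 0 \<in> F" and 12: "\<psi> 1 \<in> F \<or> \<psi> 2 \<in> F"
  have "cyclic_list gadget_edges [0, 1, 17]" "cyclic_list gadget_edges [0, 2, 17]" by code_simp+
  then have "\<psi> 17 \<notin> F" using hit[of "[0, 1, 17]"] hit[of "[0, 2, 17]"] 0 12 by auto
  then have 17: "17 \<in> ?D" by simp
  have "(?D - {17}) \<inter> set c \<noteq> {}" if c_in: "c \<in> set (map (removeAll 0) apex_cycles)" for c
  proof -
    from c_in obtain b where b: "b \<in> set apex_cycles" "c = removeAll 0 b" unfolding set_map by (rule imageE)
    have c: "cyclic_list gadget_edges b" "\<forall>i\<in>set b. i = 0 \<or> 3 \<le> i \<and> i < 19 \<and> i \<noteq> 17"
      using apex_cycles_valid b(1) by (auto simp: list_all_iff)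
    then have "set b \<subseteq> {..<19}" by auto
    from hit[OF c(1) this] obtain i where i: "i \<in> set b" "\<psi> i \<notin> F" by blast
    then have "i \<noteq> 0" using 0 by metis
    then have "i \<in> (?D - {17}) \<inter> set c" using c(2) i b(2) by auto
    then show ?thesis by blast
  qed
  then have "7 < card (?D - {17})" by (intro hits_exceed_sound(1)[OF apex_cycles_hits]) auto
  then show "card {i \<in> {3..<19}. \<psi> i \<in> F} \<le> 7" using card 17 by (simp add: card_Diff_singleton)
qed

text \<open>The copy of the gadget with apex \<open>a\<close> inside a triangle \<open>a b c\<close>; its core is shifted by \<open>off\<close>.\<close>

definition gadget_vertex :: "nat \<Rightarrow> nat \<Rightarrow> nat \<Rightarrow> nat \<Rightarrow> nat \<Rightarrow> nat" where
  "gadget_vertex a b c off i = (if i = 0 then a else if i = 1 then b else if i = 2 then c else off + i)"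

definition gadget_image :: "nat \<times> nat \<times> nat \<times> nat \<Rightarrow> (nat \<times> nat) list" where
  "gadget_image = (\<lambda>(a, b, c, off).
     map (\<lambda>(x, y). (gadget_vertex a b c off x, gadget_vertex a b c off y)) gadget_edges)"

text \<open>A block has 52 vertices: a complete graph on 0, 1, 2, 3 and a gadget in each of its three faces at
  the vertex 3. The apices 0, 1, 2 are chosen such that every edge of the complete graph joins the
  apex of some gadget to another vertex of the triangle around that gadget.\<close>

definition block_requirements :: "(nat \<times> nat) list" where
  "block_requirements = [(0,1), (0,2), (0,3), (1,2), (1,3), (2,3)] @
     concat (map gadget_image [(0,1,3,1), (1,2,3,17), (2,0,3,33)])"

lemma card_shift: 
  fixes m n k :: nat shows "card {i \<in> {m..<n}. P (k + i)} = card {i \<in> {k + m..<k + n}. P i}"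
proof (rule bij_betw_same_card)
  show "bij_betw ((+) k) {i \<in> {m..<n}. P (k + i)} {i \<in> {k + m..<k + n}. P i}"
    by (rule bij_betw_byWitness[where f' = "\<lambda>i. i - k"]) (auto simp: image_iff)
qed

lemma card_Un4_le: "card (A \<union> B \<union> C \<union> D) \<le> card A + card B + card C + card D"
  using card_Un_le[of "A \<union> B \<union> C" D] card_Un_le[of "A \<union> B" C] card_Un_le[of A B] by linarith

text \<open>A forest contains at most two vertices of the complete graph, and at most 8 core vertices of
  each gadget. If it contains two vertices of the complete graph, one of them is the apex of a gadget
  with both of them in its triangle, so that one gadget contributes at most 7.\<close>

lemma block_bound:
  fixes \<phi> :: "nat \<Rightarrow> 'a"
  assumes inj: "inj \<phi>" and f: "forest (induced_edges E F)"
    and E: "\<And>x y. (x, y) \<in> set block_requirements \<Longrightarrow> {\<phi> x, \<phi> y} \<in> E"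
  shows "card {i \<in> {..<52}. \<phi> i \<in> F} \<le> 25"
proof -
  let ?n = "\<lambda>off. card {i \<in> {off + 3..<off + 19}. \<phi> i \<in> F}"
  have g: "?n off \<le> 8" "\<phi> a \<in> F \<Longrightarrow> \<phi> b \<in> F \<or> \<phi> c \<in> F \<Longrightarrow> ?n off \<le> 7"
    if pos: "(a, b, c, off) \<in> {(0,1,3,1), (1,2,3,17), (2,0,3,33)}" for a b c off
  proof -
    let ?\<psi> = "\<phi> \<circ> gadget_vertex a b c off"
    have "inj_on (gadget_vertex a b c off) {..<19}"
      using that by (auto simp: inj_on_def gadget_vertex_def)
    then have i: "inj_on ?\<psi> {..<19}" using inj by (meson comp_inj_on inj_on_subset subset_UNIV)
    have e: "{?\<psi> x, ?\<psi> y} \<in> E" if xy: "(x, y) \<in> set gadget_edges" for x y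
    proof -
      have "(gadget_vertex a b c off x, gadget_vertex a b c off y) \<in> set (gadget_image (a, b, c, off))"
        using xy unfolding gadget_image_def by force
      moreover have "(a, b, c, off) \<in> set [(0,1,3,1), (1,2,3,17), (2,0,3,33)]" using pos by simp
      ultimately have "(gadget_vertex a b c off x, gadget_vertex a b c off y) \<in> set block_requirements"
        unfolding block_requirements_def set_append set_concat set_map by blast
      from E[OF this] show ?thesis by simp
    qed
    have eq: "{i \<in> {3..<19}. ?\<psi> i \<in> F} = {i \<in> {3..<19}. \<phi> (off + i) \<in> F}"
      by (auto simp: gadget_vertex_def)
    have n: "card {i \<in> {3..<19}. ?\<psi> i \<in> F} = ?n off"
      by (rule trans[OF arg_cong[OF eq, of card] card_shift[of 3 19 "\<lambda>i. \<phi> i \<in> F" off]])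
    show "?n off \<le> 8" using gadget_bound(1)[OF i f e] unfolding n .
    show "?n off \<le> 7" if "\<phi> a \<in> F" "\<phi> b \<in> F \<or> \<phi> c \<in> F"
      using gadget_bound(2)[OF i f e] that unfolding n by (simp add: gadget_vertex_def)
  qed
  have tri: "\<not> (\<phi> x \<in> F \<and> \<phi> y \<in> F \<and> \<phi> z \<in> F)" 
    if "(x, y, z) \<in> {(0,1,2), (0,1,3), (0,2,3), (1,2,3)}" for x y z
  proof -
    have c: "cyclic_list [(0,1),(0,2),(0,3),(1,2),(1,3),(2,3)] [x, y, z]"
      using that by (auto simp: cyclic_list_def)
    have "\<exists>i\<in>set [x, y, z]. \<phi> i \<notin> F"
    proof (rule forest_misses_cycle[OF f c])
      show "inj_on \<phi> (set [x, y, z])" using inj by (rule inj_on_subset) simp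
      show "{\<phi> a, \<phi> b} \<in> E" if "(a, b) \<in> set [(0,1),(0,2),(0,3),(1,2),(1,3),(2,3)]" for a b
        by (rule E) (use that in \<open>simp only: block_requirements_def set_append Un_iff simp_thms\<close>)
    qed
    then show ?thesis by auto
  qed
  have eq: "{i \<in> {..<52}. \<phi> i \<in> F} = {i \<in> {0, 1, 2, 3}. \<phi> i \<in> F} \<union> {i \<in> {1 + 3..<1 + 19}. \<phi> i \<in> F}
      \<union> {i \<in> {17 + 3..<17 + 19}. \<phi> i \<in> F} \<union> {i \<in> {33 + 3..<33 + 19}. \<phi> i \<in> F}"
    by auto
  have "card {i \<in> {..<52}. \<phi> i \<in> F} \<le> card {i \<in> {0, 1, 2, 3}. \<phi> i \<in> F} + ?n 1 + ?n 17 + ?n 33"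
    unfolding eq by (rule card_Un4_le)
  moreover have "card {i \<in> {0, 1, 2, 3}. \<phi> i \<in> F} =
     of_bool (\<phi> 0 \<in> F) + of_bool (\<phi> 1 \<in> F) + of_bool (\<phi> 2 \<in> F) + of_bool (\<phi> 3 \<in> F)"
  proof -
    have *: "{i \<in> insert a A. P i} = (if P a then insert a {i \<in> A. P i} else {i \<in> A. P i})" for a :: nat and A P by auto
    show ?thesis unfolding * by simp
  qed
  ultimately have "card {i \<in> {..<52}. \<phi> i \<in> F} \<le>
     of_bool (\<phi> 0 \<in> F) + of_bool (\<phi> 1 \<in> F) + of_bool (\<phi> 2 \<in> F) + of_bool (\<phi> 3 \<in> F) + ?n 1 + ?n 17 + ?n 33"
    by simp
  moreover have "p0 + p1 + p2 + p3 + n1 + n2 + n3 \<le> (25 :: nat)"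
    if "p0 = of_bool P0" "p1 = of_bool P1" "p2 = of_bool P2" "p3 = of_bool P3" "n1 \<le> 8" "n2 \<le> 8" "n3 \<le> 8"
      "P0 \<Longrightarrow> P1 \<or> P3 \<Longrightarrow> n1 \<le> 7" "P1 \<Longrightarrow> P2 \<or> P3 \<Longrightarrow> n2 \<le> 7" "P2 \<Longrightarrow> P0 \<or> P3 \<Longrightarrow> n3 \<le> 7"
      "\<not> (P0 \<and> P1 \<and> P2)" "\<not> (P0 \<and> P1 \<and> P3)" "\<not> (P0 \<and> P2 \<and> P3)" "\<not> (P1 \<and> P2 \<and> P3)"
    for p0 p1 p2 p3 n1 n2 n3 and P0 P1 P2 P3
    using that by (cases P0; cases P1; cases P2; cases P3) simp_all
  from this[OF refl refl refl refl g(1)[of 0 1 3 1] g(1)[of 1 2 3 17] g(1)[of 2 0 3 33]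
      g(2)[of 0 1 3 1] g(2)[of 1 2 3 17] g(2)[of 2 0 3 33] tri[of 0 1 2] tri[of 0 1 3] tri[of 0 2 3] tri[of 1 2 3]]
  have "of_bool (\<phi> 0 \<in> F) + of_bool (\<phi> 1 \<in> F) + of_bool (\<phi> 2 \<in> F) + of_bool (\<phi> 3 \<in> F) + ?n 1 + ?n 17 + ?n 33 \<le> 25"
    by simp
  ultimately show ?thesis by (rule order_trans)
qed

section \<open>Nested blocks\<close>

text \<open>A description of a block inside the triangle 0, 1, 2. It takes some edge of the current face and
  draws the triangle on the other side of this edge, whose third vertex is either new (\<open>Vertex\<close>) or
  already on the face (\<open>Chord\<close>); finished triangles are moved to the end (\<open>Next\<close>).\<close>

definition block_program :: "draw_step list" where
  "block_program =
    [Vertex 18, Next, Vertex 3, Next, Vertex 30, Next, Vertex 21, Next, Vertex 25, Next, Vertex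
    34, Next, Chord 1, Next, Vertex 50, Next, Chord 2, Rotate 1, Chord 1, Vertex 9, Next, Vertex
    17, Next, Vertex 14, Next, Chord 1, Next, Rotate 1, Vertex 5, Next, Vertex 19, Next, Vertex
    11, Next, Chord 1, Next, Vertex 4, Next, Vertex 8, Next, Chord 3, Rotate 1, Chord 2, Chord
    1, Next, Next, Next, Vertex 13, Next, Vertex 15, Next, Vertex 10, Next, Chord 1, Next, Chord
    1, Next, Vertex 16, Next, Vertex 12, Next, Chord 2, Rotate 1, Chord 1, Next, Next, Rotate 1,
    Chord 4, Vertex 6, Next, Vertex 7, Next, Chord 1, Next, Rotate 1, Chord 4, Rotate 1, Chord
    3, Chord 2, Rotate 1, Chord 1, Next, Next, Next, Next, Next, Next, Next, Chord 3, Rotate 1,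
    Chord 2, Vertex 24, Next, Vertex 29, Next, Vertex 35, Next, Chord 1, Next, Vertex 33, Next,
    Chord 1, Next, Vertex 20, Next, Vertex 32, Next, Vertex 28, Next, Chord 1, Next, Vertex 31,
    Next, Vertex 26, Next, Vertex 27, Next, Chord 1, Next, Rotate 1, Chord 7, Chord 1, Next,
    Vertex 23, Next, Vertex 22, Next, Chord 1, Next, Chord 1, Next, Chord 5, Rotate 1, Chord 4,
    Chord 3, Rotate 1, Chord 2, Rotate 2, Chord 1, Next, Next, Next, Next, Next, Next, Next,
    Next, Rotate 1, Chord 1, Vertex 41, Next, Vertex 49, Next, Vertex 46, Next, Chord 1, Next,
    Rotate 1, Vertex 37, Next, Vertex 51, Next, Vertex 43, Next, Chord 1, Next, Vertex 36, Next,
    Vertex 40, Next, Chord 3, Rotate 1, Chord 2, Chord 1, Next, Next, Next, Vertex 45, Next,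
    Vertex 47, Next, Vertex 42, Next, Chord 1, Next, Chord 1, Next, Vertex 48, Next, Vertex 44,
    Next, Chord 2, Rotate 1, Chord 1, Next, Next, Rotate 1, Chord 4, Vertex 38, Next, Vertex 39,
    Next, Chord 1, Next, Rotate 1, Chord 4, Rotate 1, Chord 3, Chord 2, Rotate 1, Chord 1, Next,
    Next, Next, Next, Next, Next]"

definition block_check :: bool where
  "block_check \<longleftrightarrow> (case draw_all block_program ([], [], [[0, 1, 2]]) of
     None \<Rightarrow> False
   | Some (vs, es, fs) \<Rightarrow> (\<forall>i\<in>set [3..<52]. i \<in> set vs) \<and> (\<forall>i\<in>set vs. 3 \<le> i \<and> i < 52) \<and>
       (\<forall>c\<in>set fs. length c = 3) \<and> fs \<noteq> [] \<and> hd fs = [3, 34, 2] \<and>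
       (\<forall>(x, y)\<in>set block_requirements.
          (x, y) \<in> set ([(0, 1), (1, 2), (2, 0)] @ es) \<or> (y, x) \<in> set ([(0, 1), (1, 2), (2, 0)] @ es)))"

text \<open>The evaluation is plain rewriting; the binary representation of numbers keeps it short.\<close>

lemma block_check: block_check by code_simp

lemma block_program_vertices: "Vertex x \<in> set block_program \<Longrightarrow> 3 \<le> x \<and> x < 52"
  unfolding block_program_def by auto

lemma draw_block:
  obtains vs es fs where "draw_all block_program ([], [], [[0, 1, 2]]) = Some (vs, es, [3, 34, 2] # fs)"
    "set vs = {3..<52}" "\<forall>c\<in>set fs. length c = 3"
    "\<And>x y. (x, y) \<in> set block_requirements \<Longrightarrow>
       (x, y) \<in> {(0, 1), (1, 2), (2, 0)} \<union> set es \<or> (y, x) \<in> {(0, 1), (1, 2), (2, 0)} \<union> set es"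
proof -
  have *: "case draw_all block_program ([], [], [[0, 1, 2]]) of None \<Rightarrow> False | Some (vs, es, fs) \<Rightarrow> P vs es fs \<Longrightarrow>
      \<exists>vs es fs. draw_all block_program ([], [], [[0, 1, 2]]) = Some (vs, es, fs) \<and> P vs es fs" for P
    by (cases "draw_all block_program ([], [], [[0, 1, 2]])") auto
  from *[OF block_check[unfolded block_check_def]] obtain vs es fs
    where r: "draw_all block_program ([], [], [[0, 1, 2]]) = Some (vs, es, fs)"
      and c: "\<forall>i\<in>set [3..<52]. i \<in> set vs" "\<forall>i\<in>set vs. 3 \<le> i \<and> i < 52"
        "\<forall>c\<in>set fs. length c = 3" "fs \<noteq> []" "hd fs = [3, 34, 2]"
      and req: "\<forall>(x, y)\<in>set block_requirements.
          (x, y) \<in> set ([(0, 1), (1, 2), (2, 0)] @ es) \<or> (y, x) \<in> set ([(0, 1), (1, 2), (2, 0)] @ es)"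
    by (elim exE conjE) (rule that)
  obtain fs' where fs: "fs = [3, 34, 2] # fs'" using c(4,5) by (cases fs) auto
  have "{3..<52} \<subseteq> set vs" using c(1) unfolding set_upt by blast
  moreover have "set vs \<subseteq> {3..<52}" using c(2) by (intro subsetI) simp
  ultimately have vs: "set vs = {3..<52}" by (intro equalityI)
  have "\<forall>c\<in>set fs'. length c = 3" using c(3) unfolding fs by simp
  moreover have "(x, y) \<in> {(0, 1), (1, 2), (2, 0)} \<union> set es \<or> (y, x) \<in> {(0, 1), (1, 2), (2, 0)} \<union> set es"
    if "(x, y) \<in> set block_requirements" for x y
    using bspec[OF req that] unfolding set_append list.set prod.case .
  ultimately show thesis by (rule that[OF r[unfolded fs] vs])
qed

lemma plane_map_head_edges:
  assumes "plane_map V E ([u, v, w] # cs)"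
  shows "{{u, v}, {v, w}, {w, u}} \<subseteq> E"
proof -
  obtain p g O' fs where d: "plane_drawing V E ([u, v, w] # cs) p g O' fs"
    using assms unfolding plane_map_def by blast
  have "facial_cycle E [u, v, w]" using plane_drawing_head[OF d] .
  then show ?thesis by (simp add: facial_cycle_def cycle_edges_def)
qed

lemma plane_map_add_block:
  fixes \<phi> :: "nat \<Rightarrow> nat"
  assumes inj: "inj \<phi>" and pm: "plane_map V E (map \<phi> [0, 1, 2] # cs)" and new: "\<phi> ` {3..<52} \<inter> V = {}"
  obtains E' fs where "plane_map (V \<union> \<phi> ` {3..<52}) E' (map \<phi> [3, 34, 2] # fs @ cs)" "E \<subseteq> E'"
    "\<forall>c\<in>set fs. length c = 3" "\<forall>(x, y)\<in>set block_requirements. {\<phi> x, \<phi> y} \<in> E'"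
proof -
  obtain vs es fs where r: "draw_all block_program ([], [], [[0, 1, 2]]) = Some (vs, es, [3, 34, 2] # fs)"
    and vs: "set vs = {3..<52}" and fs: "\<forall>c\<in>set fs. length c = 3"
    and req: "\<And>x y. (x, y) \<in> set block_requirements \<Longrightarrow>
       (x, y) \<in> {(0, 1), (1, 2), (2, 0)} \<union> set es \<or> (y, x) \<in> {(0, 1), (1, 2), (2, 0)} \<union> set es"
    using draw_block by blast
  have "\<phi> x \<notin> V" if "Vertex x \<in> set block_program" for x
  proof -
    have "x \<in> {3..<52}" using block_program_vertices[OF that] by simp
    then have "\<phi> x \<in> \<phi> ` {3..<52}" by (rule imageI)
    then show ?thesis using new by (metis disjoint_iff)
  qed
  from draw_all_sound[OF inj pm r this] 
  have pm': "plane_map (V \<union> \<phi> ` {3..<52}) (E \<union> map_edges \<phi> (set es)) (map \<phi> [3, 34, 2] # map (map \<phi>) fs @ cs)"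
    unfolding vs by simp
  have "{\<phi> x, \<phi> y} \<in> E \<union> map_edges \<phi> (set es)" if "(x, y) \<in> set block_requirements" for x y
  proof -
    have head: "{{\<phi> 0, \<phi> 1}, {\<phi> 1, \<phi> 2}, {\<phi> 2, \<phi> 0}} \<subseteq> E"
      using plane_map_head_edges[of V E "\<phi> 0" "\<phi> 1" "\<phi> 2" cs] pm unfolding list.map by blast
    have "{\<phi> a, \<phi> b} \<in> E \<union> map_edges \<phi> (set es)" if "(a, b) \<in> {(0, 1), (1, 2), (2, 0)} \<union> set es" for a b
    proof (cases "(a, b) \<in> set es")
      case True
      then show ?thesis by (force simp: map_edges_def)
    next
      case False
      then have "(a, b) = (0, 1) \<or> (a, b) = (1, 2) \<or> (a, b) = (2, 0)" using that by blast
      then have "{\<phi> a, \<phi> b} \<in> {{\<phi> 0, \<phi> 1}, {\<phi> 1, \<phi> 2}, {\<phi> 2, \<phi> 0}}"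
        by (elim disjE) simp_all
      then show ?thesis using head by blast
    qed
    then have "{\<phi> x, \<phi> y} \<in> E \<union> map_edges \<phi> (set es) \<or> {\<phi> y, \<phi> x} \<in> E \<union> map_edges \<phi> (set es)"
      using req[OF that] by blast
    then show ?thesis by (simp only: insert_commute simp_thms)
  qed
  then have "\<forall>(x, y)\<in>set block_requirements. {\<phi> x, \<phi> y} \<in> E \<union> map_edges \<phi> (set es)" by blast
  moreover have "\<forall>c\<in>set (map (map \<phi>) fs). length c = 3" using fs by simp
  ultimately show thesis using that[OF pm' Un_upper1] by blast
qed

text \<open>The old face with vertices 3, 34, 2 receives a new triangle 52, 53, 54 in its interior, and the
  region between the two triangles is triangulated as in the octahedron. The next block is drawn
  inside the new triangle.\<close>

definition ring_program :: "draw_step list" where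
  "ring_program = [Vertex 52, Next, Rotate 1, Vertex 53, Next, Rotate 1, Vertex 54, Next,
     Rotate 2, Chord 1, Next, Chord 1, Next, Chord 1, Next]"

lemma draw_ring:
  "\<exists>es fs. draw_all ring_program ([], [], [[3, 34, 2]]) = Some ([54, 53, 52], es, [52, 53, 54] # fs) \<and>
     (\<forall>c\<in>set fs. length c = 3)"
  by (simp add: ring_program_def eval_nat_numeral)

lemma plane_map_add_ring:
  fixes \<phi> :: "nat \<Rightarrow> nat"
  assumes inj: "inj \<phi>" and pm: "plane_map V E (map \<phi> [3, 34, 2] # cs)" and new: "\<phi> ` {52, 53, 54} \<inter> V = {}"
  obtains E' fs where "plane_map (V \<union> \<phi> ` {52, 53, 54}) E' (map \<phi> [52, 53, 54] # fs @ cs)" "E \<subseteq> E'"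
    "\<forall>c\<in>set fs. length c = 3"
proof -
  obtain es fs where r: "draw_all ring_program ([], [], [[3, 34, 2]]) = Some ([54, 53, 52], es, [52, 53, 54] # fs)"
    and fs: "\<forall>c\<in>set fs. length c = 3" using draw_ring by blast
  have "\<phi> x \<notin> V" if "Vertex x \<in> set ring_program" for x
    using that new by (auto simp: ring_program_def)
  from draw_all_sound[OF inj pm r this]
  have "plane_map (V \<union> \<phi> ` {52, 53, 54}) (E \<union> map_edges \<phi> (set es)) (map \<phi> [52, 53, 54] # map (map \<phi>) fs @ cs)"
    by (simp add: insert_commute)
  then show thesis using that fs by auto
qed

lemma induced_forest_mono:
  assumes "forest (induced_edges E' F)" "E \<subseteq> E'"
  shows "forest (induced_edges E F)"
  using assms unfolding forest_def graph_cycle_def induced_edges_def by blast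

text \<open>The blocks are nested: each new block is drawn inside the face that was left at the front of the
  list by the previous one. A forest of the whole graph induces a forest in each block.\<close>

lemma nested_blocks:
  "\<exists>E cs. plane_map {..<52 * Suc n} E (map (\<lambda>i. 52 * n + i) [3, 34, 2] # cs) \<and> (\<forall>c\<in>set cs. length c = 3) \<and>
     (\<forall>F. forest (induced_edges E F) \<longrightarrow> card (F \<inter> {..<52 * Suc n}) \<le> 25 * Suc n)"
proof (induction n)
  case 0
  have new: "(\<lambda>i. 52 * 0 + i) ` {3..<52} \<inter> {0, 1, 2 :: nat} = {}" by auto
  have inj: "inj (\<lambda>i :: nat. 52 * 0 + i)" by (simp add: inj_on_def)
  have pm: "plane_map {0, 1, 2} {{0, 1}, {1, 2}, {2, 0}} (map (\<lambda>i :: nat. 52 * 0 + i) [0, 1, 2] # [])"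
    using plane_map_triangle by simp
  obtain E fs where E: "plane_map ({0, 1, 2} \<union> (\<lambda>i. 52 * 0 + i) ` {3..<52}) E (map (\<lambda>i. 52 * 0 + i) [3, 34, 2] # fs @ [])"
    and "{{0, 1}, {1, 2}, {2, 0}} \<subseteq> E" and fs: "\<forall>c\<in>set fs. length c = 3"
    and req: "\<forall>(x, y)\<in>set block_requirements. {52 * 0 + x, 52 * 0 + y} \<in> E"
    using plane_map_add_block[OF inj pm new] .
  have "{0, 1, 2} \<union> (\<lambda>i. 52 * 0 + i) ` {3..<52} = {..<52 * Suc 0 :: nat}" by auto
  with E have pm: "plane_map {..<52 * Suc 0} E (map (\<lambda>i. 52 * 0 + i) [3, 34, 2] # fs)" by simp
  have "card (F \<inter> {..<52 * Suc 0}) \<le> 25 * Suc 0" if "forest (induced_edges E F)" for F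
  proof -
    have "card {i \<in> {..<52}. 52 * 0 + i \<in> F} \<le> 25"
      by (rule block_bound[OF inj that]) (use req in blast)
    moreover have "{i \<in> {..<52}. 52 * 0 + i \<in> F} = F \<inter> {..<52 * Suc 0}" by auto
    ultimately show ?thesis by simp
  qed
  then show ?case using pm fs by blast
next
  case (Suc n)
  define \<phi> where "\<phi> i = 52 * n + i" for i :: nat
  define \<psi> where "\<psi> i = 52 * Suc n + i" for i :: nat
  obtain E cs where pm: "plane_map {..<52 * Suc n} E (map \<phi> [3, 34, 2] # cs)" and cs: "\<forall>c\<in>set cs. length c = 3"
    and bound: "\<And>F. forest (induced_edges E F) \<Longrightarrow> card (F \<inter> {..<52 * Suc n}) \<le> 25 * Suc n"
    using Suc unfolding \<phi>_def by blast
  have inj: "inj \<phi>" "inj \<psi>" by (auto simp: inj_on_def \<phi>_def \<psi>_def)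
  have new: "\<phi> ` {52, 53, 54} \<inter> {..<52 * Suc n} = {}" by (auto simp: \<phi>_def)
  obtain E1 fs1 where E1: "plane_map ({..<52 * Suc n} \<union> \<phi> ` {52, 53, 54}) E1 (map \<phi> [52, 53, 54] # fs1 @ cs)"
    and sub1: "E \<subseteq> E1" and fs1: "\<forall>c\<in>set fs1. length c = 3"
    using plane_map_add_ring[OF inj(1) pm new] .
  \<comment> \<open>The labels 52, 53, 54 relative to one block are the labels 0, 1, 2 relative to the next one.\<close>
  have "map \<phi> [52, 53, 54] = map \<psi> [0, 1, 2]" by (simp add: \<phi>_def \<psi>_def)
  with E1 have E1': "plane_map ({..<52 * Suc n} \<union> \<phi> ` {52, 53, 54}) E1 (map \<psi> [0, 1, 2] # fs1 @ cs)" by simp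
  have new1: "\<psi> ` {3..<52} \<inter> ({..<52 * Suc n} \<union> \<phi> ` {52, 53, 54}) = {}" by (auto simp: \<phi>_def \<psi>_def)
  obtain E2 fs2 where E2: "plane_map ({..<52 * Suc n} \<union> \<phi> ` {52, 53, 54} \<union> \<psi> ` {3..<52}) E2
       (map \<psi> [3, 34, 2] # fs2 @ fs1 @ cs)"
    and sub2: "E1 \<subseteq> E2" and fs2: "\<forall>c\<in>set fs2. length c = 3"
    and req: "\<forall>(x, y)\<in>set block_requirements. {\<psi> x, \<psi> y} \<in> E2"
    using plane_map_add_block[OF inj(2) E1' new1] .
  have V: "{..<52 * Suc n} \<union> \<phi> ` {52, 53, 54} \<union> \<psi> ` {3..<52} = {..<52 * Suc (Suc n)}"
  proof (intro equalityI subsetI)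
    fix x assume x: "x \<in> {..<52 * Suc (Suc n)}"
    define i where "i = x - 52 * Suc n"
    show "x \<in> {..<52 * Suc n} \<union> \<phi> ` {52, 53, 54} \<union> \<psi> ` {3..<52}"
    proof (cases "x < 52 * Suc n")
      case False
      then have xi: "x = \<psi> i" "i < 52" using x by (auto simp: i_def \<psi>_def)
      have "\<psi> 0 = \<phi> 52" "\<psi> 1 = \<phi> 53" "\<psi> 2 = \<phi> 54" by (simp_all add: \<phi>_def \<psi>_def)
      moreover have "i = 0 \<or> i = 1 \<or> i = 2 \<or> i \<in> {3..<52}" using xi(2) by auto
      ultimately show ?thesis unfolding xi(1) by auto
    qed simp
  qed (auto simp: \<phi>_def \<psi>_def)
  have "card (F \<inter> {..<52 * Suc (Suc n)}) \<le> 25 * Suc (Suc n)" if F: "forest (induced_edges E2 F)" for F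
  proof -
    have "E \<subseteq> E2" using sub1 sub2 by (rule subset_trans)
    then have "card (F \<inter> {..<52 * Suc n}) \<le> 25 * Suc n" by (rule bound[OF induced_forest_mono[OF F]])
    moreover have "card (\<psi> ` {i \<in> {..<52}. \<psi> i \<in> F}) \<le> 25"
    proof -
      have "card (\<psi> ` {i \<in> {..<52}. \<psi> i \<in> F}) \<le> card {i \<in> {..<52}. \<psi> i \<in> F}"
        by (rule card_image_le) simp
      also have "\<dots> \<le> 25" by (rule block_bound[OF inj(2) F]) (use req in blast)
      finally show ?thesis .
    qed
    moreover have "F \<inter> {..<52 * Suc (Suc n)} \<subseteq> (F \<inter> {..<52 * Suc n}) \<union> \<psi> ` {i \<in> {..<52}. \<psi> i \<in> F}"
    proof
      fix x assume x: "x \<in> F \<inter> {..<52 * Suc (Suc n)}"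
      show "x \<in> (F \<inter> {..<52 * Suc n}) \<union> \<psi> ` {i \<in> {..<52}. \<psi> i \<in> F}"
      proof (cases "x < 52 * Suc n")
        case False
        then have "x = \<psi> (x - 52 * Suc n)" "x - 52 * Suc n < 52" using x by (auto simp: \<psi>_def)
        then show ?thesis using x by (metis (mono_tags, lifting) IntD1 UnI2 image_eqI lessThan_iff mem_Collect_eq)
      qed (use x in simp)
    qed
    then have "card (F \<inter> {..<52 * Suc (Suc n)}) \<le> card ((F \<inter> {..<52 * Suc n}) \<union> \<psi> ` {i \<in> {..<52}. \<psi> i \<in> F})"
      by (intro card_mono) auto
    moreover have "w \<le> 25 * Suc (Suc n)" if "x \<le> 25 * Suc n" "y \<le> 25" "w \<le> z" "z \<le> x + y" for w x y z
      using that by simp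
    ultimately show ?thesis
      using card_Un_le[of "F \<inter> {..<52 * Suc n}" "\<psi> ` {i \<in> {..<52}. \<psi> i \<in> F}"] by blast
  qed
  moreover have "\<forall>c\<in>set (fs2 @ fs1 @ cs). length c = 3" using cs fs1 fs2 by auto
  ultimately show ?case using E2 unfolding V \<psi>_def by blast
qed

theorem corollary4p2:
  fixes k :: nat
  assumes "k \<ge> 1"
  shows "\<exists>(V :: nat set) E. planar_triangulation V E \<and> card V = 52 * k \<and>
           max_induced_forest V E \<le> 25 * k"
proof -
  obtain n where k: "k = Suc n" using assms by (cases k) auto
  obtain E cs where pm: "plane_map {..<52 * k} E (map (\<lambda>i. 52 * n + i) [3, 34, 2] # cs)"
    and cs: "\<forall>c\<in>set cs. length c = 3"
    and bound: "\<And>F. forest (induced_edges E F) \<Longrightarrow> card (F \<inter> {..<52 * k}) \<le> 25 * k"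
    using nested_blocks[of n] unfolding k by blast
  have "planar_triangulation {..<52 * k} E"
    by (rule planar_triangulation_plane_map[OF pm]) (use cs in simp)
  moreover have "max_induced_forest {..<52 * k} E \<le> 25 * k"
  proof -
    let ?S = "{F. F \<subseteq> {..<52 * k} \<and> forest (induced_edges E F)}"
    have "simple_graph {..<52 * k} E" using pm by (simp add: plane_map_def)
    then have "induced_edges E {} = {}" by (auto simp: induced_edges_def simple_graph_def)
    moreover have "\<not> graph_cycle {} vs" for vs :: "nat list"
      unfolding graph_cycle_def by (metis empty_iff gr0I length_greater_0_conv list.size(3) not_numeral_le_zero)
    ultimately have "forest (induced_edges E {})" by (simp add: forest_def)
    then have "card ` ?S \<noteq> {}" by auto
    moreover have "finite (card ` ?S)" by simp
    moreover have "card F \<le> 25 * k" if "F \<in> ?S" for F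
      using bound[of F] that by (simp add: Int_absorb2)
    ultimately show ?thesis unfolding max_induced_forest_def by (simp add: Max_le_iff)
  qed
  ultimately show ?thesis by (intro exI[of _ "{..<52 * k}"] exI[of _ E]) simp
qed

end
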